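(* Let $n\ge 3$ and consider the affine Weyl group $W_{\mathrm{aff}}$ of type $A_{n-1}^{(1)}$. Let $\alpha\in\Pi_{\mathrm{aff}}^{\mathrm{re},+}$ with $\alpha<c$, let $m$ be a positive integer, and let $$\Pi_{\mathrm{aff}}^{\mathrm{re},+}(\alpha)=\{\beta'\in\Pi_{\mathrm{aff}}^{\mathrm{re},+}:\ \beta'<c,\ \text{and either } \beta'\le c-\alpha,\ \text{or both } \beta'>\alpha \text{ and } \beta'\perp\alpha\}.$$ Then: (1) $\Gamma_{mc+\alpha}(id)=\{t_{m\beta'}s_\alpha:\beta'\in\Pi_{\mathrm{aff}}^{\mathrm{re},+}(\alpha),\ \alpha_0\notin\operatorname{supp}(\beta')\}\cup\{t_{m(\beta'-c)}s_\alpha:\beta'\in\Pi_{\mathrm{aff}}^{\mathrm{re},+}(\alpha),\ \alpha_0\in\operatorname{supp}(\beta')\}$; (2) $|\Gamma_{mc+\alpha}(id)|=|\Pi_{\mathrm{aff}}^{\mathrm{re},+}(\alpha)|$; (3) $\ell(w)=2m(n-1)+\ell(s_\alpha)$ for all $w\in\Gamma_{mc+\alpha}(id)$.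
   Context: Roots. Let $n\ge 3$. Let $\alpha_0,\dots,\alpha_{n-1}$ (indices mod $n$) be the affine simple roots of type $A_{n-1}^{(1)}$, $Q_{\mathrm{aff}}=\bigoplus_{i=0}^{n-1}\mathbb Z\alpha_i$, with symmetric form $\langle\alpha_i,\alpha_i\rangle=2$, $\langle\alpha_i,\alpha_{i\pm1}\rangle=-1$, all other $\langle\alpha_i,\alpha_j\rangle=0$; $\perp$ refers to this form. For $a,b\in Q_{\mathrm{aff}}$, $a\le b$ means $b-a$ has non-negative coefficients, and $a<b$ means $a\le b$, $a\ne b$. Put $c=\sum_{i=0}^{n-1}\alpha_i$ (identified with the imaginary root $\delta$). Let $\Pi=\Pi^+\sqcup\Pi^-$ be the finite root system of type $A_{n-1}$ with simple roots $\alpha_1,\dots,\alpha_{n-1}$. The affine real roots are $\alpha+mc$ with $\alpha\in\Pi$, $m\in\mathbb Z$; such a root is positive if $m>0$, or $m=0$ and $\alpha\in\Pi^+$. The set of positive real roots is $\Pi_{\mathrm{aff}}^{\mathrm{re},+}$. For $\alpha=\sum a_i\alpha_i$, $\operatorname{supp}(\alpha)=\{\alpha_i:a_i\ne0\}$. Weyl group. For a real root $\alpha$, $s_\alpha(\mu)=\mu-\langle\mu,\alpha\rangle\alpha$. $W_{\mathrm{aff}}$ is the group generated by $s_i=s_{\alpha_i}$, $0\le i\le n-1$ (a Coxeter group with these generators), with length $\ell$ and Bruhat order $\le$. One has $W_{\mathrm{aff}}=W\ltimes Q$, where $W=\langle s_1,\dots,s_{n-1}\rangle$ and $Q=\bigoplus_{i=1}^{n-1}\mathbb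 Z\alpha_i$ (root and coroot lattices identified); $t_\mu$ denotes the image of $\mu\in Q$, with $s_{\alpha+mc}=s_\alpha t_{m\alpha}$ for $\alpha\in\Pi$, $m\in\mathbb Z$ (so $t_\mu(\nu)=\nu-\langle\mu,\nu\rangle c$). For a positive real root $\beta'<c$: $\beta'\in Q$ if $\alpha_0\notin\operatorname{supp}(\beta')$, and $\beta'-c\in Q$ if $\alpha_0\in\operatorname{supp}(\beta')$. Curve neighborhoods. The moment graph has vertex set $W_{\mathrm{aff}}$ and an edge $u\stackrel{\alpha}{\longrightarrow}us_\alpha$ of degree $\alpha$ for each $u\in W_{\mathrm{aff}}$, $\alpha\in\Pi_{\mathrm{aff}}^{\mathrm{re},+}$. The degree of a chain (a succession of adjacent edges, possibly empty) is the sum of the degrees of its edges. A degree is a tuple $\mathbf d=(d_0,\dots,d_{n-1})\in\mathbb Z_{\ge0}^n$, identified with $\sum d_i\alpha_i$; degrees are ordered componentwise. For $u\in W_{\mathrm{aff}}$, $\Gamma_{\mathbf d}(u)$ is the set of Bruhat-maximal elements of the set of all $v\in W_{\mathrm{aff}}$ that can be joined to some $u'\le u$ by a chain of degree $\le\mathbf d$. *)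

theory Defs
  imports "HOL-Library.Function_Algebras" "HOL-Algebra.Bij" "HOL-Algebra.Generated_Groups"
begin

section \<open>The affine root lattice of type \<open>A\<^sub>n\<^sub>-\<^sub>1\<close>\<close>

text \<open>
  The vector \<open>a :: nat \<Rightarrow> int\<close> with \<open>a i = 0\<close> for \<open>i \<ge> n\<close> stands for
  \<open>\<Sum>i<n. a i \<alpha>\<^sub>i\<close>.  Addition and the orders \<open>\<le>\<close>, \<open><\<close> are the pointwise
  ones on functions, so \<open>a \<le> b\<close> says that \<open>b - a\<close> has non-negative coefficients, and
  \<open>a < b\<close> says \<open>a \<le> b\<close> and \<open>a \<noteq> b\<close>.
\<close>

type_synonym rvec = "nat \<Rightarrow> int"

definition scale :: "int \<Rightarrow> rvec \<Rightarrow> rvec" (infixr "*\<^sub>Z" 75)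
  where "k *\<^sub>Z a = (\<lambda>i. k * a i)"

definition simple_root :: "nat \<Rightarrow> rvec"
  where "simple_root i = (\<lambda>j. if j = i then 1 else 0)"

definition cartan :: "nat \<Rightarrow> nat \<Rightarrow> nat \<Rightarrow> int"
  where "cartan n i j =
    (if i = j then 2
     else if j = (i + 1) mod n \<or> i = (j + 1) mod n then - 1
     else 0)"

definition form :: "nat \<Rightarrow> rvec \<Rightarrow> rvec \<Rightarrow> int"
  where "form n a b = (\<Sum>i<n. \<Sum>j<n. a i * b j * cartan n i j)"

definition cc :: "nat \<Rightarrow> rvec"
  where "cc n = (\<Sum>i<n. simple_root i)"

definition supp :: "nat \<Rightarrow> rvec \<Rightarrow> rvec set"
  where "supp n a = {simple_root i | i. i < n \<and> a i \<noteq> 0}"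

text \<open>
  In type \<open>A\<^sub>n\<^sub>-\<^sub>1\<close> the positive roots \<open>\<epsilon>\<^sub>i - \<epsilon>\<^sub>j\<^sub>+\<^sub>1\<close> are the sums
  \<open>\<alpha>\<^sub>i + \<dots> + \<alpha>\<^sub>j\<close> with \<open>1 \<le> i \<le> j \<le> n - 1\<close>.
\<close>

definition fin_pos_roots :: "nat \<Rightarrow> rvec set"
  where "fin_pos_roots n = {(\<Sum>k=i..j. simple_root k) | i j. 1 \<le> i \<and> i \<le> j \<and> j < n}"

definition fin_roots :: "nat \<Rightarrow> rvec set"
  where "fin_roots n = fin_pos_roots n \<union> uminus ` fin_pos_roots n"

definition pos_real_roots :: "nat \<Rightarrow> rvec set"
  where "pos_real_roots n =
    {\<alpha> + m *\<^sub>Z cc n | \<alpha> m. \<alpha> \<in> fin_roots n \<and> (m > 0 \<or> (m = 0 \<and> \<alpha> \<in> fin_pos_roots n))}"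


section \<open>The affine Weyl group\<close>

definition reflect :: "nat \<Rightarrow> rvec \<Rightarrow> rvec \<Rightarrow> rvec"
  where "reflect n \<alpha> \<mu> = \<mu> - form n \<mu> \<alpha> *\<^sub>Z \<alpha>"

text \<open>The translation \<open>t\<^sub>\<mu>\<close>; only meant for \<open>\<mu>\<close> in the finite root lattice.\<close>

definition transl :: "nat \<Rightarrow> rvec \<Rightarrow> rvec \<Rightarrow> rvec"
  where "transl n \<mu> \<nu> = \<nu> - form n \<mu> \<nu> *\<^sub>Z cc n"

text \<open>
  The group acts on all of \<open>nat \<Rightarrow> int\<close>.  Since \<open>form n\<close> reads only the coordinates below
  \<open>n\<close> and the roots live there, the remaining coordinates are fixed by every generator, so
  this is the same group as the one acting on the affine root lattice.  The product of
  \<open>BijGroup UNIV\<close> is composition of maps.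
\<close>

definition Waff :: "nat \<Rightarrow> (rvec \<Rightarrow> rvec) set"
  where "Waff n = generate (BijGroup UNIV) {reflect n (simple_root i) | i. i < n}"

definition word_prod :: "nat \<Rightarrow> nat list \<Rightarrow> rvec \<Rightarrow> rvec"
  where "word_prod n is = foldr (\<lambda>i w. reflect n (simple_root i) \<circ> w) is id"

definition len :: "nat \<Rightarrow> (rvec \<Rightarrow> rvec) \<Rightarrow> nat"
  where "len n w = (LEAST k. \<exists>is. set is \<subseteq> {..<n} \<and> length is = k \<and> word_prod n is = w)"

text \<open>
  The Coxeter-theoretic reflections (conjugates of the generators) are the \<open>s\<^sub>\<alpha>\<close> for positive
  real roots \<open>\<alpha>\<close>; the Bruhat order is the reflexive transitive closure of the
  length-increasing multiplications by reflections.
\<close>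

definition bruhat_step :: "nat \<Rightarrow> (rvec \<Rightarrow> rvec) \<Rightarrow> (rvec \<Rightarrow> rvec) \<Rightarrow> bool"
  where "bruhat_step n u v \<longleftrightarrow>
    u \<in> Waff n \<and> (\<exists>\<alpha>\<in>pos_real_roots n. v = u \<circ> reflect n \<alpha> \<and> len n u < len n v)"

definition bruhat_le :: "nat \<Rightarrow> (rvec \<Rightarrow> rvec) \<Rightarrow> (rvec \<Rightarrow> rvec) \<Rightarrow> bool"
  where "bruhat_le n u v \<longleftrightarrow> u \<in> Waff n \<and> v \<in> Waff n \<and> (bruhat_step n)\<^sup>*\<^sup>* u v"


section \<open>Curve neighborhoods\<close>

text \<open>\<open>chain n u d v\<close>: the moment graph has a chain of degree \<open>d\<close> from \<open>u\<close> to \<open>v\<close>.\<close>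

inductive chain :: "nat \<Rightarrow> (rvec \<Rightarrow> rvec) \<Rightarrow> rvec \<Rightarrow> (rvec \<Rightarrow> rvec) \<Rightarrow> bool"
  for n :: nat and u :: "rvec \<Rightarrow> rvec"
  where
    empty: "u \<in> Waff n \<Longrightarrow> chain n u 0 u"
  | edge: "chain n u d v \<Longrightarrow> \<alpha> \<in> pos_real_roots n \<Longrightarrow> chain n u (d + \<alpha>) (v \<circ> reflect n \<alpha>)"

definition reachable :: "nat \<Rightarrow> rvec \<Rightarrow> (rvec \<Rightarrow> rvec) \<Rightarrow> (rvec \<Rightarrow> rvec) set"
  where "reachable n d u =
    {v \<in> Waff n. \<exists>u' e. bruhat_le n u' u \<and> e \<le> d \<and> chain n u' e v}"

definition curve_nbhd :: "nat \<Rightarrow> rvec \<Rightarrow> (rvec \<Rightarrow> rvec) \<Rightarrow> (rvec \<Rightarrow> rvec) set"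
  where "curve_nbhd n d u =
    {v \<in> reachable n d u. \<forall>w\<in>reachable n d u. bruhat_le n v w \<longrightarrow> w = v}"

definition pos_real_roots_at :: "nat \<Rightarrow> rvec \<Rightarrow> rvec set"
  where "pos_real_roots_at n \<alpha> =
    {\<beta> \<in> pos_real_roots n. \<beta> < cc n \<and> (\<beta> \<le> cc n - \<alpha> \<or> (\<alpha> < \<beta> \<and> form n \<beta> \<alpha> = 0))}"

end

theory Submission
  imports Defs
begin

text \<open>
  Realise \<open>W\<^sub>a\<^sub>f\<^sub>f\<close> as the group of affine permutations \<open>w\<close> of the integers; the positive real root
  \<open>\<alpha>\<^sub>a + \<dots> + \<alpha>\<^sub>b\<^sub>-\<^sub>1\<close> (indices mod \<open>n\<close>, \<open>a < b\<close>, \<open>a \<noteq> b\<close> mod \<open>n\<close>) corresponds to the periodic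
  transposition of \<open>a\<close> and \<open>b\<close>.  Let \<open>r\<^sub>j(w)\<close> be the number of \<open>c \<le> j\<close> with \<open>w c > j\<close>.  If \<open>a < b\<close> and
  \<open>w a < w b\<close>, then exchanging the values at \<open>a\<close> and \<open>b\<close> raises the vector \<open>r(w)\<close> by the degree of the
  cyclic interval \<open>[a, b) \<inter> [w a, w b)\<close>.  Consequently \<open>w\<close> is reachable from the identity in
  degree \<open>d\<close> iff \<open>r(w) \<le> d\<close>: sort \<open>w\<close> by exchanges with \<open>w b \<le> a < b \<le> w a\<close>.

  For \<open>d = m c + \<alpha>\<close>, where \<open>\<alpha>\<close> belongs to \<open>[p, q)\<close>, suppose that no length-increasing exchange keeps
  \<open>r(w) \<le> d\<close>.  Then overlapping arcs \<open>[c, w c)\<close> are strictly nested, exactly one of them modulo \<open>n\<close>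
  has length at least \<open>n\<close>, and \<open>r(w) = d\<close> everywhere; applied to \<open>w\<close> and to its inverse, this
  leaves only \<open>w = t s\<^sub>\<alpha>\<close> with \<open>t\<close> shifting one class by \<open>m n\<close> and another one by \<open>- m n\<close>.  These elements all
  have the same length by the floor formula for inversions, so none lies below another, and every
  reachable element lies below one of them.
\<close>

section \<open>Cyclic intervals and their root vectors\<close>

locale affine_type_A =
  fixes n :: nat
  assumes n_ge_3: "3 \<le> n"
begin

abbreviation N :: int where "N \<equiv> int n"

lemma N_pos: "0 < N" and N_ge_3: "3 \<le> N"
  using n_ge_3 by simp_all

section \<open>Congruence modulo \<open>n\<close>\<close>

definition cg :: "int \<Rightarrow> int \<Rightarrow> bool" where "cg a b \<longleftrightarrow> N dvd a - b"

lemma cg_refl [simp]: "cg a a"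
  by (simp add: cg_def)

lemma cg_sym: "cg a b \<longleftrightarrow> cg b a"
  by (simp add: cg_def dvd_diff_commute)

lemma cg_trans: "cg a b \<Longrightarrow> cg b c \<Longrightarrow> cg a c"
  unfolding cg_def using dvd_add[of N "a - b" "b - c"] by simp

lemma cg_common: "cg u z \<Longrightarrow> cg v z \<Longrightarrow> cg u v"
  and cg_common': "cg z u \<Longrightarrow> cg z v \<Longrightarrow> cg u v"
  using cg_trans[of u z v] cg_sym[of v z] cg_sym[of z u] by simp_all

lemma cg_iff: "cg a b \<longleftrightarrow> (\<exists>k. a = b + k * N)"
proof -
  have "a = b + k * N \<longleftrightarrow> a - b = N * k" for k
    by (auto simp: algebra_simps)
  then show ?thesis unfolding cg_def dvd_def by simp
qed

lemma cg_shift [simp]: "cg (a + k * N) b \<longleftrightarrow> cg a b" "cg b (a + k * N) \<longleftrightarrow> cg b a"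
proof -
  have "N dvd a + k * N - b \<longleftrightarrow> N dvd a - b"
    using dvd_add_right_iff[of N "k * N" "a - b"] by (simp add: algebra_simps)
  then show 1: "cg (a + k * N) b \<longleftrightarrow> cg a b" by (simp add: cg_def)
  then show "cg b (a + k * N) \<longleftrightarrow> cg b a" by (simp add: cg_sym)
qed

lemma cg_shift_one [simp]: "cg (a + N) b \<longleftrightarrow> cg a b" "cg b (a + N) \<longleftrightarrow> cg b a"
  using cg_shift(1)[of a 1 b] cg_shift(2)[of b a 1] by simp_all

lemma cg_mod [simp]: "cg (a mod N) b \<longleftrightarrow> cg a b" "cg b (a mod N) \<longleftrightarrow> cg b a"
proof -
  have "a = a mod N + (a div N) * N" by simp
  then show "cg (a mod N) b \<longleftrightarrow> cg a b" "cg b (a mod N) \<longleftrightarrow> cg b a"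
    by (metis cg_shift)+
qed

lemma cg_close: "cg a b \<Longrightarrow> a < b + N \<Longrightarrow> b < a + N \<Longrightarrow> a = b"
  unfolding cg_def using zdvd_not_zless[of "a - b" N] zdvd_not_zless[of "b - a" N]
  by (smt (verit) dvd_diff_commute)

lemma not_cg_close: "a < b \<Longrightarrow> b < a + N \<Longrightarrow> \<not> cg a b"
  using cg_close by fastforce

lemma window_rep: obtains k where "x \<le> b + k * N" "b + k * N < x + N"
proof -
  let ?k = "- ((b - x) div N)"
  have "b + ?k * N = x + (b - x) mod N"
    by (simp add: minus_div_mult_eq_mod[symmetric])
  then have "x \<le> b + ?k * N" "b + ?k * N < x + N"
    using N_pos by (simp_all add: pos_mod_bound)
  then show thesis by (rule that)
qed

text \<open>For \<open>a \<le> b\<close> this counts the integers congruent to \<open>j\<close> in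
  \<open>[a, b)\<close>, the multiplicity of \<open>\<alpha>\<^sub>j\<close> in the cyclic interval.
  As a difference of two values of one potential it is additive and antisymmetric without case
  distinctions.\<close>

definition arc :: "int \<Rightarrow> int \<Rightarrow> int \<Rightarrow> int"
  where "arc a b j = (b - 1 - j) div N - (a - 1 - j) div N"

lemma arc_add: "arc a b j + arc b c j = arc a c j"
  by (simp add: arc_def)

lemma arc_self [simp]: "arc a a j = 0"
  by (simp add: arc_def)

lemma arc_swap: "arc b a j = - arc a b j"
  by (simp add: arc_def)

lemma arc_nonneg: "a \<le> b \<Longrightarrow> 0 \<le> arc a b j"
  using N_pos by (simp add: arc_def zdiv_mono1)

lemma div_shift: "(a + k * N) div N = a div N + k"
  using N_pos by (simp add: mult.commute)

lemma potential_shift: "(c + k * N - 1 - j) div N = (c - 1 - j) div N + k"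
  using div_shift[of "c - 1 - j" k] by (simp add: algebra_simps)

lemma potential_shift_index: "(c - 1 - (j + k * N)) div N = (c - 1 - j) div N - k"
  using div_shift[of "c - 1 - j" "-k"] by (simp add: algebra_simps)

lemma arc_shift [simp]: "arc (a + k * N) (b + k * N) j = arc a b j"
  by (simp add: arc_def potential_shift)

lemma arc_shift_one [simp]: "arc (a + N) (b + N) j = arc a b j"
  using arc_shift[of a 1 b j] by simp

lemma arc_index [simp]: "arc a b (j + k * N) = arc a b j"
  by (simp add: arc_def potential_shift_index)

lemma arc_full: "arc a (a + k * N) j = k"
  by (simp add: arc_def potential_shift)

lemma arc_full_one: "arc a (a + N) j = 1"
  using arc_full[of a 1] by simp

lemma arc_extend: "arc a (b + k * N) j = arc a b j + k"
  by (simp add: arc_def potential_shift)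

lemma arc_cg: "cg i j \<Longrightarrow> arc a b i = arc a b j"
  by (auto simp: cg_iff)

lemma small_div: "- N \<le> a \<Longrightarrow> a < N \<Longrightarrow> a div N = (if 0 \<le> a then 0 else -1)"
  using div_shift[of "a + N" "-1"] by (auto simp: div_pos_pos_trivial)

text \<open>Both numerators lie in \<open>[- n, n)\<close>, where the quotient is \<open>0\<close>
  or \<open>- 1\<close>.\<close>

lemma arc_window:
  assumes "x \<le> j" "j < x + N" "x \<le> a" "a \<le> b" "b \<le> x + N"
  shows "arc a b j = (if a \<le> j \<and> j < b then 1 else 0)"
  using assms small_div[of "b - 1 - j"] small_div[of "a - 1 - j"] by (simp add: arc_def)

lemma arc_pos:
  assumes "0 < arc a b j"
  obtains k where "a \<le> j + k * N" "j + k * N < b"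
proof -
  \<comment> \<open>\<open>j + ?k * N\<close> is the largest member of the class of \<open>j\<close>
    below \<open>b\<close>.\<close>
  let ?k = "(b - 1 - j) div N"
  have "j + ?k * N \<le> b - 1"
    using div_mult_mod_eq[of "b - 1 - j" N] N_pos pos_mod_sign[of N "b - 1 - j"] by linarith
  moreover have "a \<le> j + ?k * N"
  proof (rule ccontr)
    assume "\<not> a \<le> j + ?k * N"
    then have "0 + ?k * N \<le> a - 1 - j" by simp
    then have "?k \<le> (a - 1 - j) div N"
      using zdiv_mono1[OF _ N_pos] div_shift[of 0 ?k] by fastforce
    with assms show False by (simp add: arc_def)
  qed
  ultimately show thesis by (intro that[of ?k]) simp_all
qed

lemma arc_ge_1:
  assumes "a \<le> j" "j < b"
  shows "1 \<le> arc a b j"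
proof -
  have "arc a b j = arc a j j + arc j (j+1) j + arc (j+1) b j"
    by (simp add: arc_add)
  moreover have "arc j (j+1) j = 1"
    using arc_window[of j j j "j+1"] N_ge_3 by simp
  ultimately show ?thesis
    using arc_nonneg[of a j j] arc_nonneg[of "j+1" b j] assms by simp
qed

lemma arc_one: "arc a (a + 1) j = (if cg j a then 1 else 0)"
proof -
  obtain k where k: "a \<le> j + k * N" "j + k * N < a + N" by (rule window_rep)
  have "arc a (a+1) (j + k * N) = (if j + k * N = a then 1 else 0)"
    using arc_window[of a "j + k * N" a "a+1"] k N_ge_3 by auto
  moreover have "cg j a \<longleftrightarrow> j + k * N = a"
    using cg_close[of "j + k * N" a] k by auto
  ultimately show ?thesis by simp
qed

section \<open>Sums over one period\<close>

lemma periodic_mult: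
  assumes "\<And>i. f (i + N) = (f i :: int)"
  shows "f (i + k * N) = f i"
proof (induction k rule: int_induct[where k = 0])
  case (step1 k) then show ?case using assms[of "i + k * N"] by (simp add: algebra_simps)
next
  case (step2 k) then show ?case using assms[of "i + (k - 1) * N"] by (simp add: algebra_simps)
qed simp

lemma periodic_cg:
  assumes "\<And>i. f (i + N) = (f i :: int)" "cg i j"
  shows "f i = f j"
  using periodic_mult[of f, OF assms(1)] assms(2) by (auto simp: cg_iff)

lemma sum_pick:
  assumes "\<And>i. f (i + N) = (f i :: int)"
  shows "(\<Sum>i\<in>{x..<x+N}. if cg i a then f i else 0) = f a"
proof -
  obtain k where k: "x \<le> a + k * N" "a + k * N < x + N" by (rule window_rep)
  have "cg i a \<longleftrightarrow> i = a + k * N" if "i \<in> {x..<x+N}" for i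
    using cg_close[of i "a + k * N"] k that by auto
  then have "(\<Sum>i\<in>{x..<x+N}. if cg i a then f i else 0)
      = (\<Sum>i\<in>{x..<x+N}. if i = a + k * N then f i else 0)"
    by (intro sum.cong) auto
  also have "\<dots> = f (a + k * N)" using k by simp
  finally show ?thesis by (simp add: periodic_mult[of f] assms)
qed

lemma sum_nat_window: "(\<Sum>i<n. f (int i)) = (\<Sum>i\<in>{0..<N}. f i)"
  by (rule sum.reindex_bij_witness[where i = nat and j = int]) auto

text \<open>Each integer of \<open>[a, b)\<close> contributes its own increment of \<open>F\<close>,
  and only the increments, not the values, have to be periodic. Intervals of length one are
  immediate and both sides are additive.\<close>

lemma telescope:
  assumes "\<And>i. F (i + N + 1) - F (i + N) = F (i + 1) - (F i :: int)"
  shows "(\<Sum>i\<in>{0..<N}. arc a b i * (F (i + 1) - F i)) = F b - F a"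
proof -
  let ?S = "\<lambda>a b. \<Sum>i\<in>{0..<N}. arc a b i * (F (i + 1) - F i)"
  have add: "?S a b + ?S b c = ?S a c" for a b c
    by (simp add: arc_add[of a b _ c, symmetric] sum.distrib[symmetric] algebra_simps)
  have one: "?S a (a + 1) = F (a + 1) - F a" for a
  proof -
    have "?S a (a + 1) = (\<Sum>i\<in>{0..<0+N}. if cg i a then F (i + 1) - F i else 0)"
      by (intro sum.cong) (auto simp: arc_one)
    also have "\<dots> = F (a + 1) - F a"
      by (rule sum_pick) (simp add: assms)
    finally show ?thesis .
  qed
  have "?S a (a + k) = F (a + k) - F a" for k
  proof (induction k rule: int_induct[where k = 0])
    case (step1 k)
    then show ?case using add[of a "a + k" "a + k + 1"] one[of "a + k"] by (simp add: algebra_simps)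
  next
    case (step2 k)
    then show ?case
      using add[of a "a + (k - 1)" "a + k"] one[of "a + (k - 1)"] by (simp add: algebra_simps)
  qed simp
  from this[of "b - a"] show ?thesis by simp
qed

lemma sum_arc: "(\<Sum>i\<in>{0..<N}. arc a b i) = b - a"
  using telescope[of "\<lambda>i. i" a b] by simp

text \<open>With \<open>\<alpha>\<^sub>i = \<epsilon>\<^sub>i -
  \<epsilon>\<^sub>i\<^sub>+\<^sub>1\<close> this stands for
  \<open>\<epsilon>\<^sub>a - \<epsilon>\<^sub>b\<close>, where moving one index by \<open>n\<close>
  changes the multiple of \<open>cc n\<close>. Reversed endpoints give the negative.\<close>

definition root :: "int \<Rightarrow> int \<Rightarrow> rvec"
  where "root a b = (\<lambda>j. if j < n then arc a b (int j) else 0)"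

lemma root_le_iff: "root a b \<le> root c d \<longleftrightarrow> (\<forall>j. arc a b j \<le> arc c d j)"
proof
  assume L: "root a b \<le> root c d"
  show "\<forall>j. arc a b j \<le> arc c d j"
  proof
    fix j
    have "arc a b (int (nat (j mod N))) \<le> arc c d (int (nat (j mod N)))"
      using L[unfolded le_fun_def, rule_format, of "nat (j mod N)"] N_pos
      by (auto simp: root_def nat_less_iff split: if_splits)
    moreover have "cg (int (nat (j mod N))) j" using N_pos by simp
    ultimately show "arc a b j \<le> arc c d j" by (metis arc_cg)
  qed
qed (auto simp: root_def le_fun_def)

lemma root_eq_iff: "root a b = root c d \<longleftrightarrow> (\<forall>j. arc a b j = arc c d j)"
  unfolding order_eq_iff[of "root a b"] root_le_iff by (auto intro: antisym)

lemma cc_eq: "cc n = root a (a + N)"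
proof -
  have "(\<Sum>i\<in>A. simple_root i) j = (if j \<in> A then 1 else 0)" if "finite A" for A j
    using that by (induction A) (auto simp: simple_root_def)
  then show ?thesis by (auto simp: cc_def root_def arc_full_one)
qed

lemma simple_root_eq: "i < n \<Longrightarrow> simple_root i = root (int i) (int i + 1)"
  using not_cg_close[of "int i"] not_cg_close[of _ "int i"]
  by (auto simp: root_def arc_one simple_root_def fun_eq_iff neq_iff cg_sym[of "int i"])

lemma root_add: "root a b + root b c = root a c"
  by (auto simp: root_def arc_add fun_eq_iff)

lemma root_shift: "root (a + k * N) (b + k * N) = root a b"
  by (simp add: root_def fun_eq_iff)

lemma root_extend: "root a (b + k * N) = root a b + k *\<^sub>Z cc n"
  by (auto simp: root_def cc_eq[of 0] arc_extend scale_def arc_full_one[of 0, simplified] fun_eq_iff)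

lemma root_swap: "root b a = - root a b"
  by (auto simp: root_def arc_swap[of a b] fun_eq_iff)

lemma interval_root:
  assumes "i \<le> j" "j < n"
  shows "(\<Sum>k=i..j. simple_root k) = root (int i) (int j + 1)"
  using assms
proof (induction j rule: dec_induct)
  case base then show ?case by (simp add: simple_root_eq)
next
  case (step j)
  then have "(\<Sum>k=i..Suc j. simple_root k) = root (int i) (int j + 1) + root (int j + 1) (int j + 2)"
    by (simp add: simple_root_eq[of "Suc j"] algebra_simps)
  then show ?case by (simp add: root_add algebra_simps)
qed

lemma fin_pos_roots_eq: "fin_pos_roots n = {root a b | a b. 1 \<le> a \<and> a < b \<and> b \<le> N}"
proof (intro subset_antisym subsetI)
  fix \<beta> assume "\<beta> \<in> fin_pos_roots n"
  then obtain i j where "1 \<le> i" "i \<le> j" "j < n" "\<beta> = root (int i) (int j + 1)"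
    unfolding fin_pos_roots_def using interval_root by auto
  then show "\<beta> \<in> {root a b | a b. 1 \<le> a \<and> a < b \<and> b \<le> N}" by force
next
  fix \<beta> assume "\<beta> \<in> {root a b | a b. 1 \<le> a \<and> a < b \<and> b \<le> N}"
  then obtain a b where ab: "1 \<le> a" "a < b" "b \<le> N" "\<beta> = root a b" by auto
  then have "\<beta> = (\<Sum>k=nat a..nat (b - 1). simple_root k)"
    by (subst interval_root) auto
  moreover have "1 \<le> nat a" "nat a \<le> nat (b - 1)" "nat (b - 1) < n" using ab by auto
  ultimately show "\<beta> \<in> fin_pos_roots n" unfolding fin_pos_roots_def by blast
qed

lemma fin_pos_rootI: "1 \<le> a \<Longrightarrow> a < b \<Longrightarrow> b \<le> N \<Longrightarrow> root a b \<in> fin_pos_roots n"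
  unfolding fin_pos_roots_eq by blast

text \<open>Moving the right endpoint by \<open>m * N\<close> adds \<open>m *\<^sub>Z cc n\<close>.
  Conversely both endpoints are brought into \<open>[1, n]\<close>, and the periods left over form
  the multiple of \<open>cc n\<close>; congruent endpoints would give an imaginary root.\<close>

lemma pos_real_roots_eq: "pos_real_roots n = {root a b | a b. a < b \<and> \<not> cg a b}"
proof (intro subset_antisym subsetI)
  fix \<beta> assume "\<beta> \<in> pos_real_roots n"
  then obtain \<alpha> m where \<beta>: "\<beta> = \<alpha> + m *\<^sub>Z cc n" and \<alpha>: "\<alpha> \<in> fin_roots n"
    and m: "m > 0 \<or> m = 0 \<and> \<alpha> \<in> fin_pos_roots n"
    unfolding pos_real_roots_def by auto
  have m0: "0 \<le> m" using m by auto
  have mN: "N \<le> m * N" if "m > 0" using that N_pos by (simp add: mult_le_cancel_right)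
  show "\<beta> \<in> {root a b | a b. a < b \<and> \<not> cg a b}"
  proof (cases "\<alpha> \<in> fin_pos_roots n")
    case True
    then obtain a b where ab: "\<alpha> = root a b" "1 \<le> a" "a < b" "b \<le> N"
      by (auto simp: fin_pos_roots_eq)
    moreover have "a < b + m * N" using ab m0 N_pos by (smt (verit) mult_nonneg_nonneg)
    ultimately show ?thesis
      unfolding \<beta> using not_cg_close[of a b] root_extend[of a b m] cg_shift(2)[of a b m]
      by (smt (verit) mem_Collect_eq)
  next
    case False
    then obtain a b where ab: "\<alpha> = - root a b" "1 \<le> a" "a < b" "b \<le> N"
      using \<alpha> by (auto simp: fin_roots_def fin_pos_roots_eq)
    have "m > 0" using m False by auto
    then have "b < a + m * N" using ab mN by linarith
    then show ?thesis
      unfolding \<beta> using not_cg_close[of a b] ab root_extend[of b a m] root_swap[of b a]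
        cg_shift(2)[of b a m] cg_sym[of a b]
      by (smt (verit) mem_Collect_eq)
  qed
next
  fix \<beta> assume "\<beta> \<in> {root a b | a b. a < b \<and> \<not> cg a b}"
  then obtain a b where ab: "\<beta> = root a b" "a < b" "\<not> cg a b" by auto
  obtain k where k: "1 \<le> a + k * N" "a + k * N < 1 + N" by (rule window_rep)
  obtain l where l: "1 \<le> b + l * N" "b + l * N < 1 + N" by (rule window_rep)
  let ?a = "a + k * N" and ?b = "b + l * N"
  \<comment> \<open>Both endpoints move by \<open>k\<close> periods. As \<open>?b\<close> has
    already moved by \<open>l\<close>, the difference is the coefficient of
    \<open>cc n\<close>.\<close>
  have "\<beta> = root ?a (?b + (k - l) * N)"
    using root_shift[of a k b] ab(1) by (simp add: algebra_simps)
  then have \<beta>: "\<beta> = root ?a ?b + (k - l) *\<^sub>Z cc n" by (simp only: root_extend)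
  have less: "?a < ?b + (k - l) * N" using ab by (simp add: algebra_simps)
  have ne: "?a \<noteq> ?b" using ab(3) by (metis cg_refl cg_shift)
  show "\<beta> \<in> pos_real_roots n"
  proof (cases "?a < ?b")
    case True
    then have "root ?a ?b \<in> fin_pos_roots n" using k l by (intro fin_pos_rootI) auto
    moreover have "0 \<le> k - l"
    proof (rule ccontr)
      assume "\<not> 0 \<le> k - l"
      then have "(k - l) * N \<le> (-1) * N" by (intro mult_right_mono) auto
      then show False using less k l by linarith
    qed
    ultimately show ?thesis unfolding \<beta> pos_real_roots_def fin_roots_def by fastforce
  next
    case False
    then have "root ?b ?a \<in> fin_pos_roots n" using k l ne by (intro fin_pos_rootI) auto
    then have "root ?a ?b \<in> fin_roots n"
      unfolding fin_roots_def root_swap[where a = ?b and b = ?a] by blast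
    moreover have "0 < k - l"
    proof (rule ccontr)
      assume "\<not> 0 < k - l"
      then have "(k - l) * N \<le> 0" by (simp add: mult_nonpos_nonneg)
      then show False using less False ne by linarith
    qed
    ultimately show ?thesis unfolding \<beta> pos_real_roots_def by fastforce
  qed
qed

text \<open>The coefficient of \<open>\<epsilon>\<^sub>a\<close> in \<open>\<mu>\<close>, indices
  read modulo \<open>n\<close>.\<close>

definition eps :: "rvec \<Rightarrow> int \<Rightarrow> int"
  where "eps \<mu> a = \<mu> (nat (a mod N)) - \<mu> (nat ((a - 1) mod N))"

lemma eps_shift: "eps \<mu> (a + N) = eps \<mu> a"
proof -
  have "(a + N - 1) mod N = (a - 1) mod N"
    using mod_add_self2[of "a - 1" N] by (simp add: algebra_simps)
  then show ?thesis by (simp add: eps_def)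
qed

definition ind :: "int \<Rightarrow> int \<Rightarrow> int"
  where "ind c a = (if cg c a then 1 else 0)"

lemma ind_shift [simp]: "ind (c + N) a = ind c a" "ind (c + k * N) a = ind c a"
  "ind c (a + N) = ind c a" "ind c (a + k * N) = ind c a"
  by (simp_all add: ind_def)

lemma sum_ind:
  assumes "\<And>i. f (i + N) = (f i :: int)"
  shows "(\<Sum>i\<in>{x..<x+N}. ind i a * f i) = f a"
proof -
  have "(\<Sum>i\<in>{x..<x+N}. ind i a * f i) = (\<Sum>i\<in>{x..<x+N}. if cg i a then f i else 0)"
    by (intro sum.cong) (auto simp: ind_def)
  then show ?thesis by (simp add: sum_pick assms)
qed

definition per :: "rvec \<Rightarrow> int \<Rightarrow> int"
  where "per \<mu> a = \<mu> (nat (a mod N))"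

lemma per_shift: "per \<mu> (a + N) = per \<mu> a"
  by (simp add: per_def)

lemma per_int [simp]: "i < n \<Longrightarrow> per \<mu> (int i) = \<mu> i"
  by (simp add: per_def)

lemma eps_per: "eps \<mu> a = per \<mu> a - per \<mu> (a - 1)"
  by (simp add: eps_def per_def)

lemma eps_cg: "cg a b \<Longrightarrow> eps \<mu> a = eps \<mu> b"
  using periodic_cg[of "eps \<mu>"] eps_shift by blast

lemma per_root: "per (root a b) j = arc a b j"
proof -
  have "nat (j mod N) < n" using N_pos by (simp add: nat_less_iff)
  then show ?thesis using N_pos by (simp add: per_def root_def arc_cg)
qed

lemma sum_per: "(\<Sum>i<n. g (int i) * \<mu> i) = (\<Sum>i\<in>{0..<N}. g i * per \<mu> i)"
  by (simp add: sum_nat_window[of "\<lambda>i. g i * per \<mu> i", symmetric])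

text \<open>Since \<open>n \<ge> 3\<close>, the classes of \<open>j - 1\<close>, \<open>j\<close>
  and \<open>j + 1\<close> are distinct, so at most one indicator is nonzero. The linear shape lets
  \<open>sum_ind\<close> evaluate sums against the Cartan matrix.\<close>

lemma cartan_eq:
  assumes "i < n" "j < n"
  shows "cartan n i j = 2 * ind (int i) (int j) - ind (int i) (int j + 1) - ind (int i) (int j - 1)"
proof -
  have cong: "cg (int u) (int v) \<longleftrightarrow> u = v" if "u < n" "v < n" for u v
    using that cg_close[of "int u" "int v"] by auto
  have 1: "i = (j + 1) mod n \<longleftrightarrow> cg (int i) (int j + 1)"
    using cong[of i "(j + 1) mod n"] assms by (simp add: of_nat_mod add.commute)
  have 2: "j = (i + 1) mod n \<longleftrightarrow> cg (int i) (int j - 1)"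
  proof -
    have "cg (int j) (int i + 1) \<longleftrightarrow> cg (int i) (int j - 1)"
      by (simp add: cg_def dvd_diff_commute[of _ "int j"] algebra_simps)
    from this[symmetric] show ?thesis
      using cong[of j "(i + 1) mod n"] assms by (simp add: of_nat_mod add.commute)
  qed
  have 3: "\<not> (cg c a \<and> cg c b)" if "a < b" "b < a + N" for a b c
    using not_cg_close[of a b] that cg_trans cg_sym by blast
  show ?thesis
    using 3[of "int j" "int j + 1" "int i"] 3[of "int j - 1" "int j" "int i"]
      3[of "int j - 1" "int j + 1" "int i"] N_ge_3 cong[OF assms]
    unfolding cartan_def 1 2 ind_def by auto
qed

text \<open>Pairing with \<open>\<alpha>\<^sub>j\<close> yields
  \<open>eps \<mu> j - eps \<mu> (j + 1)\<close>, and these differences telescope along the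
  interval.\<close>

lemma form_root: "form n \<mu> (root a b) = eps \<mu> a - eps \<mu> b"
proof -
  have inner: "(\<Sum>i<n. \<mu> i * cartan n i j) = eps \<mu> (int j) - eps \<mu> (int j + 1)" if "j < n" for j
  proof -
    have "(\<Sum>i<n. \<mu> i * cartan n i j) = (\<Sum>i<n. (2 * ind (int i) (int j)
        - ind (int i) (int j + 1) - ind (int i) (int j - 1)) * \<mu> i)"
      by (intro sum.cong) (simp_all add: cartan_eq that)
    also have "\<dots> = (\<Sum>i\<in>{0..<N}. (2 * ind i (int j) - ind i (int j + 1) - ind i (int j - 1)) * per \<mu> i)"
      by (rule sum_per)
    also have "\<dots> = 2 * (\<Sum>i\<in>{0..<0+N}. ind i (int j) * per \<mu> i)
        - (\<Sum>i\<in>{0..<0+N}. ind i (int j + 1) * per \<mu> i) - (\<Sum>i\<in>{0..<0+N}. ind i (int j - 1) * per \<mu> i)"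
      by (simp add: sum_distrib_left sum_subtractf sum.distrib algebra_simps)
    also have "\<dots> = eps \<mu> (int j) - eps \<mu> (int j + 1)"
      by (subst (1 2 3) sum_ind) (simp_all add: per_shift eps_per)
    finally show ?thesis .
  qed
  have "form n \<mu> (root a b) = (\<Sum>j<n. \<Sum>i<n. \<mu> i * root a b j * cartan n i j)"
    unfolding form_def by (rule sum.swap)
  also have "\<dots> = (\<Sum>j<n. root a b j * (\<Sum>i<n. \<mu> i * cartan n i j))"
    by (simp add: sum_distrib_left algebra_simps)
  also have "\<dots> = (\<Sum>j<n. arc a b (int j) * (eps \<mu> (int j) - eps \<mu> (int j + 1)))"
    by (intro sum.cong) (simp_all add: root_def inner)
  also have "\<dots> = (\<Sum>j\<in>{0..<N}. arc a b j * (eps \<mu> j - eps \<mu> (j + 1)))"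
    by (rule sum_nat_window)
  also have "\<dots> = eps \<mu> a - eps \<mu> b"
    using telescope[of "\<lambda>j. - eps \<mu> j" a b] eps_shift[of \<mu>]
    by (simp add: eps_cg add.commute[of _ 1] add.assoc[symmetric])
  finally show ?thesis .
qed

lemma cartan_sym: "cartan n i j = cartan n j i"
  by (auto simp: cartan_def)

lemma form_sym: "form n a b = form n b a"
  unfolding form_def by (subst sum.swap) (simp add: cartan_sym[of _ _] mult.commute mult.left_commute)

lemma form_scale: "form n (k *\<^sub>Z a) b = k * form n a b"
  by (simp add: form_def scale_def sum_distrib_left algebra_simps)

lemma form_diff: "form n (a - b) c = form n a c - form n b c"
  by (simp add: form_def sum_subtractf algebra_simps)

lemma form_cc: "form n (cc n) \<nu> = 0"
  by (subst form_sym) (simp add: cc_eq[of 0] form_root eps_cg[of N 0] cg_def)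


section \<open>Affine permutations\<close>

text \<open>The sum condition removes the common shift \<open>i \<mapsto> i + 1\<close>, so this is
  the affine symmetric group and not its extended version.\<close>

definition aff :: "(int \<Rightarrow> int) set"
  where "aff = {w. bij w \<and> (\<forall>i. w (i + N) = w i + N) \<and> (\<Sum>i\<in>{0..<N}. w i - i) = 0}"

lemma aff_bij: "w \<in> aff \<Longrightarrow> bij w"
  and aff_shift_one: "w \<in> aff \<Longrightarrow> w (i + N) = w i + N"
  and aff_sum: "w \<in> aff \<Longrightarrow> (\<Sum>i\<in>{0..<N}. w i - i) = 0"
  by (auto simp: aff_def)

lemma aff_shift: "w \<in> aff \<Longrightarrow> w (i + k * N) = w i + k * N"
  using periodic_mult[of "\<lambda>i. w i - i" i k] aff_shift_one[of w] by simp

lemma aff_inj: "w \<in> aff \<Longrightarrow> w a = w b \<longleftrightarrow> a = b"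
  using aff_bij bij_is_inj inj_eq by metis

lemma aff_cg: "w \<in> aff \<Longrightarrow> cg (w a) (w b) \<longleftrightarrow> cg a b"
  unfolding cg_iff by (metis aff_shift aff_inj)

text \<open>A periodic bijection permutes the residue classes, so it only reorders the terms of a
  periodic sum. This also yields the sum condition of \<open>aff\<close> for products and
  inverses.\<close>

lemma sum_reindex_window:
  assumes w: "bij w" "\<And>i. w (i + N) = w i + N" and f: "\<And>i. f (i + N) = (f i :: int)"
  shows "(\<Sum>i\<in>{x..<x+N}. f (w i)) = (\<Sum>i\<in>{y..<y+N}. f i)"
proof -
  have wk: "w (i + k * N) = w i + k * N" for i k
    using periodic_mult[of "\<lambda>i. w i - i" i k] w(2) by simp
  \<comment> \<open>The representative of the class of \<open>w i\<close> in the target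
    window.\<close>
  define h where "h i = y + (w i - y) mod N" for i
  have hcg: "cg (h i) (w i)" for i
  proof -
    have "h i = w i + (- ((w i - y) div N)) * N"
      by (simp add: h_def minus_div_mult_eq_mod[symmetric])
    then show ?thesis by (metis cg_shift(1) cg_refl)
  qed
  have inj: "inj_on h {x..<x+N}"
  proof (rule inj_onI)
    fix i j assume ij: "i \<in> {x..<x+N}" "j \<in> {x..<x+N}" "h i = h j"
    then have "cg (w i) (w j)" using hcg cg_sym cg_trans by metis
    then obtain k where "w i = w (j + k * N)" by (auto simp: cg_iff wk)
    then have "i = j + k * N" using w(1) by (simp add: bij_is_inj inj_eq)
    then have "cg i j" by simp
    then show "i = j" using ij cg_close[of i j] by auto
  qed
  have sub: "h ` {x..<x+N} \<subseteq> {y..<y+N}"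
    using N_pos by (auto simp: h_def pos_mod_bound)
  have "h ` {x..<x+N} = {y..<y+N}"
    by (rule card_subset_eq[OF _ sub]) (simp_all add: card_image[OF inj])
  then have "(\<Sum>i\<in>{y..<y+N}. f i) = (\<Sum>i\<in>{x..<x+N}. f (h i))"
    using sum.reindex[OF inj, of f] by simp
  also have "\<dots> = (\<Sum>i\<in>{x..<x+N}. f (w i))"
    using periodic_cg[of f, OF f hcg] by simp
  finally show ?thesis by simp
qed

lemma sum_window:
  assumes "\<And>i. f (i + N) = (f i :: int)"
  shows "(\<Sum>i\<in>{x..<x+N}. f i) = (\<Sum>i\<in>{y..<y+N}. f i)"
  using sum_reindex_window[OF bij_id, of f x y] assms by simp

lemma aff_id: "(\<lambda>i. i) \<in> aff" "id \<in> aff"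
  using bij_id by (auto simp: aff_def id_def)

lemma aff_comp:
  assumes "w \<in> aff" "u \<in> aff"
  shows "w \<circ> u \<in> aff"
proof -
  have "(\<Sum>i\<in>{0..<0+N}. w (u i) - u i) = (\<Sum>i\<in>{0..<0+N}. w i - i)"
    by (rule sum_reindex_window[of u "\<lambda>i. w i - i"])
      (simp_all add: assms aff_shift_one aff_bij)
  then have "(\<Sum>i\<in>{0..<N}. w (u i) - u i) = 0" using aff_sum[OF assms(1)] by simp
  then have "(\<Sum>i\<in>{0..<N}. w (u i) - i) = 0"
    using aff_sum[OF assms(2)] by (simp add: sum_subtractf)
  then show ?thesis using assms by (auto simp: aff_def intro: bij_comp)
qed

abbreviation pinv :: "(int \<Rightarrow> int) \<Rightarrow> int \<Rightarrow> int"
  where "pinv \<equiv> inv_into UNIV"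

lemma aff_inv:
  assumes "w \<in> aff"
  shows "pinv w \<in> aff"
proof -
  have b: "bij w" by (rule aff_bij[OF assms])
  have p: "pinv w (i + N) = pinv w i + N" for i
    using b aff_shift_one[OF assms, of "pinv w i"] by (metis bij_inv_eq_iff)
  have "(\<Sum>i\<in>{0..<0+N}. pinv w (w i) - w i) = (\<Sum>i\<in>{0..<0+N}. pinv w i - i)"
    by (rule sum_reindex_window[of w "\<lambda>i. pinv w i - i"])
      (simp_all add: assms aff_shift_one aff_bij p)
  moreover have "(\<Sum>i\<in>{0..<N}. pinv w (w i) - w i) = - (\<Sum>i\<in>{0..<N}. w i - i)"
    using b by (simp add: bij_is_inj sum_negf[symmetric])
  ultimately have "(\<Sum>i\<in>{0..<N}. pinv w i - i) = 0" using aff_sum[OF assms] by simp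
  then show ?thesis using b p by (auto simp: aff_def bij_imp_bij_inv)
qed

lemma inv_apply [simp]: "w \<in> aff \<Longrightarrow> pinv w (w i) = i" "w \<in> aff \<Longrightarrow> w (pinv w i) = i"
  using aff_bij by (auto simp: bij_is_inj bij_is_surj surj_f_inv_f)

lemma inv_inv [simp]: "w \<in> aff \<Longrightarrow> pinv (pinv w) = w"
  by (simp add: aff_bij inv_inv_eq)

text \<open>For non-congruent \<open>a\<close> and \<open>b\<close>, the periodic transposition: the
  affine permutation of the reflection in \<open>root a b\<close>.\<close>

definition trp :: "int \<Rightarrow> int \<Rightarrow> int \<Rightarrow> int"
  where "trp a b c = (if cg c a then c + (b - a) else if cg c b then c + (a - b) else c)"

lemma cg_cong_add: "cg (c + d) (a + d) \<longleftrightarrow> cg c a"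
  by (simp add: cg_def)

lemma trp_cg:
  "cg c a \<Longrightarrow> cg (trp a b c) b" "\<not> cg c a \<Longrightarrow> cg c b \<Longrightarrow> cg (trp a b c) a"
  "\<not> cg c a \<Longrightarrow> \<not> cg c b \<Longrightarrow> trp a b c = c"
  using cg_cong_add[of c "b - a" a] cg_cong_add[of c "a - b" b] by (simp_all add: trp_def)

lemma trp_left [simp]: "trp a b a = b"
  and trp_right: "\<not> cg a b \<Longrightarrow> trp a b b = a"
  by (auto simp: trp_def cg_sym[of b])

lemma trp_trp: "\<not> cg a b \<Longrightarrow> trp a b (trp a b c) = c"
  using trp_cg[of c a b] cg_trans[of a "trp a b c" b] cg_sym[of a "trp a b c"]
  by (smt (verit) trp_def)

lemma trp_shift_one: "trp a b (c + N) = trp a b c + N"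
  by (simp add: trp_def)

lemma involution_bij: "(\<And>c. f (f c) = c) \<Longrightarrow> bij f"
  by (metis bijI')

lemma trp_aff: assumes "\<not> cg a b" shows "trp a b \<in> aff"
proof -
  have "(\<Sum>i\<in>{0..<0+N}. trp a b i - i)
      = (\<Sum>i\<in>{0..<0+N}. ind i a * (b - a)) + (\<Sum>i\<in>{0..<0+N}. ind i b * (a - b))"
    unfolding sum.distrib[symmetric]
    using assms cg_trans cg_sym by (intro sum.cong refl) (auto simp: trp_def ind_def, blast)
  also have "\<dots> = 0" by (subst (1 2) sum_ind) simp_all
  finally show ?thesis
    using trp_trp[OF assms] by (auto simp: aff_def trp_shift_one intro!: involution_bij)
qed

text \<open>Converts an exchange of positions (right multiplication) into an exchange of values
  (left multiplication).\<close>

lemma trp_conj: "w \<in> aff \<Longrightarrow> w \<circ> trp a b = trp (w a) (w b) \<circ> w"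
proof
  fix c assume w: "w \<in> aff"
  show "(w \<circ> trp a b) c = (trp (w a) (w b) \<circ> w) c"
    using w by (auto simp: trp_def aff_cg cg_iff[of c] aff_shift algebra_simps)
qed

text \<open>The translation in direction \<open>m (\<epsilon>\<^sub>x - \<epsilon>\<^sub>y)\<close>:
  the class of \<open>x\<close> goes up by \<open>m\<close> periods and that of \<open>y\<close>
  goes down by as many.\<close>

definition shf :: "int \<Rightarrow> int \<Rightarrow> int \<Rightarrow> int \<Rightarrow> int"
  where "shf m x y c = c + m * N * (ind c x - ind c y)"

lemma shf_cg [simp]: "cg (shf m x y c) a \<longleftrightarrow> cg c a" "ind (shf m x y c) a = ind c a"
  using cg_shift(1)[of c "m * (ind c x - ind c y)" a] by (simp_all add: shf_def ind_def algebra_simps)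

lemma shf_aff: "shf m x y \<in> aff"
proof -
  have "shf m x y (shf (-m) x y c) = c" for m c
    unfolding shf_def[of m] shf_cg by (simp add: shf_def)
  from this[of m] this[of "-m"] have "bij (shf m x y)"
    by (intro o_bij[of "shf (-m) x y"]) (auto simp: fun_eq_iff)
  moreover have "(\<Sum>i\<in>{0..<0+N}. shf m x y i - i)
      = (\<Sum>i\<in>{0..<0+N}. ind i x * (m * N)) - (\<Sum>i\<in>{0..<0+N}. ind i y * (m * N))"
    unfolding sum_subtractf[symmetric] by (intro sum.cong refl) (simp add: shf_def algebra_simps)
  then have "(\<Sum>i\<in>{0..<0+N}. shf m x y i - i) = 0"
    by (simp only: sum_ind)
  ultimately show ?thesis by (auto simp: aff_def shf_def)
qed


section \<open>The action on the affine root lattice\<close>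

text \<open>The linear extension of \<open>root i (i + 1) \<mapsto> root (w i) (w (i + 1))\<close>.
  Coordinates from \<open>n\<close> on are fixed, as they are by the generators.\<close>

definition act :: "(int \<Rightarrow> int) \<Rightarrow> rvec \<Rightarrow> rvec"
  where "act w \<mu> j =
    (if j < n then \<Sum>i<n. arc (w (int i)) (w (int i + 1)) (int j) * \<mu> i else \<mu> j)"

text \<open>The potential behind \<open>arc\<close>, read at the image points, grows by one per
  period of the source; its increments are therefore periodic and \<open>telescope\<close>
  applies.\<close>

lemma act_root:
  assumes "w \<in> aff"
  shows "act w (root a b) = root (w a) (w b)"
proof
  fix j
  show "act w (root a b) j = root (w a) (w b) j"
  proof (cases "j < n")
    case True
    define F where "F c = (w c - 1 - int j) div N" for c
    have F: "arc (w c) (w d) (int j) = F d - F c" for c d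
      by (simp add: arc_def F_def)
    have Fs: "F (c + N) = F c + 1" for c
      using potential_shift[of "w c" 1 "int j"] by (simp add: F_def aff_shift_one[OF assms])
    have "act w (root a b) j = (\<Sum>i<n. arc a b (int i) * (F (int i + 1) - F (int i)))"
      using True by (auto simp: act_def root_def F intro!: sum.cong)
    also have "\<dots> = (\<Sum>i\<in>{0..<N}. arc a b i * (F (i + 1) - F i))"
      by (rule sum_nat_window)
    also have "\<dots> = F b - F a"
      using Fs[of "_ + 1"] by (intro telescope) (simp add: Fs add.assoc add.commute[of N 1])
    finally show ?thesis using True by (simp add: root_def F)
  qed (simp add: act_def root_def)
qed

lemma act_comp:
  assumes "w \<in> aff"
  shows "act (w \<circ> u) = act w \<circ> act u"
proof (intro ext)
  fix \<mu> j
  show "act (w \<circ> u) \<mu> j = (act w \<circ> act u) \<mu> j"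
  proof (cases "j < n")
    case True
    have *: "(\<Sum>k<n. arc (w (int k)) (w (int k + 1)) (int j) * arc a b (int k)) = arc (w a) (w b) (int j)"
      for a b
      using act_root[OF assms, THEN fun_cong, of a b j] True by (simp add: act_def root_def)
    have "(act w \<circ> act u) \<mu> j = (\<Sum>k<n. arc (w (int k)) (w (int k + 1)) (int j)
         * (\<Sum>i<n. arc (u (int i)) (u (int i + 1)) (int k) * \<mu> i))"
      using True by (simp add: act_def)
    also have "\<dots> = (\<Sum>i<n. (\<Sum>k<n. arc (w (int k)) (w (int k + 1)) (int j)
         * arc (u (int i)) (u (int i + 1)) (int k)) * \<mu> i)"
      unfolding sum_distrib_left sum_distrib_right by (subst sum.swap) (simp add: mult.assoc)
    also have "\<dots> = act (w \<circ> u) \<mu> j"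
      using True by (simp add: * act_def)
    finally show ?thesis by simp
  qed (simp add: act_def)
qed

text \<open>The images of the roots \<open>root i (i + 1)\<close> determine all increments of the
  permutation, and the sum condition determines the remaining constant.\<close>

lemma act_inject:
  assumes w: "w \<in> aff" and u: "u \<in> aff" and eq: "act w = act u"
  shows "w = u"
proof -
  have "root (w i) (w (i + 1)) = root (u i) (u (i + 1))" for i
    using eq act_root[OF w] act_root[OF u] by metis
  then have "arc (w i) (w (i + 1)) j = arc (u i) (u (i + 1)) j" for i j
    by (auto simp: root_eq_iff)
  then have d: "w (i + 1) - w i = u (i + 1) - u i" for i
    using sum_arc[of "w i" "w (i+1)"] sum_arc[of "u i" "u (i+1)"] by simp
  have "w i - u i = w 0 - u 0" for i
  proof (induction i rule: int_induct[where k = 0])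
    case (step1 i) then show ?case using d[of i] by simp
  next
    case (step2 i) then show ?case using d[of "i - 1"] by simp
  qed simp
  then have shift: "w i = u i + (w 0 - u 0)" for i
    by (metis add.commute diff_add_cancel)
  have "w i - i = (u i - i) + (w 0 - u 0)" for i
    using shift[of i] by simp
  then have "(\<Sum>i\<in>{0..<N}. w i - i) = (\<Sum>i\<in>{0..<N}. (u i - i) + (w 0 - u 0))"
    by (rule sum.cong[OF refl])
  also have "\<dots> = N * (w 0 - u 0)" by (simp add: sum.distrib aff_sum[OF u] del: sum_subtractf)
  finally have "w 0 = u 0" using aff_sum[OF w] N_pos by simp
  then have "w i = u i" for i using shift[of i] by simp
  then show ?thesis by (rule ext)
qed

text \<open>Common core of reflections and translations: if the potential at \<open>j\<close>
  changes only on the classes of \<open>x\<close> and \<open>y\<close>, by \<open>K\<close> and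
  \<open>- K\<close>, then only these two classes affect the \<open>j\<close>-th coordinate.
  \<open>K\<close> may depend on \<open>j\<close>: it is \<open>arc a b j\<close> for a reflection
  and \<open>m\<close> for a translation.\<close>

lemma act_twist:
  assumes "j < n"
    and "\<And>c. (w c - 1 - int j) div N = (c - 1 - int j) div N + K * (ind c x - ind c y)"
  shows "act w \<mu> j = \<mu> j - K * (eps \<mu> x - eps \<mu> y)"
proof -
  have ind1: "ind (i + 1) a = ind i (a - 1)" for i a
    by (simp add: ind_def cg_def algebra_simps)
  have arc1: "arc i (i + 1) (int j) = ind i (int j)" for i
    by (simp add: arc_one ind_def cg_sym)
  have S: "(\<Sum>i\<in>{0..<N}. ind i a * per \<mu> i) = per \<mu> a" for a
    using sum_ind[of "per \<mu>" a 0] by (simp add: per_shift)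
  have "arc (w i) (w (i + 1)) (int j) = ind i (int j)
      + K * (ind i (x - 1) - ind i x - ind i (y - 1) + ind i y)" for i
    using arc1[of i] unfolding arc_def assms(2) ind1 by (simp add: algebra_simps)
  then have "act w \<mu> j = (\<Sum>i<n. (ind (int i) (int j) + K * (ind (int i) (x - 1) - ind (int i) x
      - ind (int i) (y - 1) + ind (int i) y)) * \<mu> i)"
    using assms(1) by (simp add: act_def)
  also have "\<dots> = (\<Sum>i\<in>{0..<N}. (ind i (int j) + K * (ind i (x - 1) - ind i x
      - ind i (y - 1) + ind i y)) * per \<mu> i)"
    by (rule sum_per)
  also have "\<dots> = (\<Sum>i\<in>{0..<N}. ind i (int j) * per \<mu> i) +
     K * ((\<Sum>i\<in>{0..<N}. ind i (x - 1) * per \<mu> i) - (\<Sum>i\<in>{0..<N}. ind i x * per \<mu> i)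
      - (\<Sum>i\<in>{0..<N}. ind i (y - 1) * per \<mu> i) + (\<Sum>i\<in>{0..<N}. ind i y * per \<mu> i))"
    by (simp add: sum_distrib_left sum.distrib sum_subtractf algebra_simps)
  also have "\<dots> = \<mu> j - K * (eps \<mu> x - eps \<mu> y)"
    unfolding S using assms(1) by (simp add: eps_per algebra_simps)
  finally show ?thesis .
qed

lemma act_id: "act id = id"
  using act_twist[of _ id 0] by (fastforce simp: act_def fun_eq_iff)

lemma act_trp:
  assumes "\<not> cg a b"
  shows "act (trp a b) = reflect n (root a b)"
proof (intro ext)
  fix \<mu> j
  show "act (trp a b) \<mu> j = reflect n (root a b) \<mu> j"
  proof (cases "j < n")
    case True
    have "(trp a b c - 1 - int j) div N = (c - 1 - int j) div N + arc a b (int j) * (ind c a - ind c b)" for c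
    proof -
      consider k where "c = a + k * N" | k where "c = b + k * N" | "\<not> cg c a" "\<not> cg c b"
        by (auto simp: cg_iff)
      then show ?thesis
      proof cases
        case 1
        then have "trp a b c = b + k * N" by (simp add: trp_def)
        moreover have "ind c a = 1" "ind c b = 0" using 1 assms by (simp_all add: ind_def)
        ultimately show ?thesis unfolding 1 by (simp add: arc_def potential_shift)
      next
        case 2
        then have "trp a b c = a + k * N" using assms by (simp add: trp_def cg_sym[of b])
        moreover have "ind c a = 0" "ind c b = 1"
          using 2 assms by (simp_all add: ind_def cg_sym[of b])
        ultimately show ?thesis unfolding 2 by (simp add: arc_def potential_shift)
      qed (simp add: trp_def ind_def)
    qed
    then have "act (trp a b) \<mu> j = \<mu> j - arc a b (int j) * (eps \<mu> a - eps \<mu> b)"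
      by (rule act_twist[OF True])
    then show ?thesis
      using True unfolding reflect_def form_root by (simp add: scale_def root_def)
  qed (simp add: act_def reflect_def scale_def root_def)
qed

text \<open>Both candidate vectors define the same translation, because \<open>cc n\<close> lies in
  the radical of the form.\<close>

lemma act_shf:
  assumes "\<mu> = m *\<^sub>Z root x y \<or> \<mu> = m *\<^sub>Z (root x y - cc n)"
  shows "act (shf m x y) = transl n \<mu>"
proof (intro ext)
  fix \<nu> j
  have f: "form n \<mu> \<nu> = m * (eps \<nu> x - eps \<nu> y)"
    using assms form_sym[of "root x y" \<nu>]
    by (auto simp: form_scale form_diff form_cc form_root)
  show "act (shf m x y) \<nu> j = transl n \<mu> \<nu> j"
  proof (cases "j < n")
    case True
    have "(shf m x y c - 1 - int j) div N = (c - 1 - int j) div N + m * (ind c x - ind c y)" for c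
      using potential_shift[of c "m * (ind c x - ind c y)" "int j"]
      by (simp add: shf_def algebra_simps)
    then have "act (shf m x y) \<nu> j = \<nu> j - m * (eps \<nu> x - eps \<nu> y)"
      by (rule act_twist[OF True])
    moreover have "cc n j = 1" using True by (simp add: cc_eq[of 0] root_def arc_full_one[of 0, simplified])
    ultimately show ?thesis by (simp add: transl_def f scale_def)
  next
    case False
    then have "cc n j = 0" by (simp add: cc_eq[of 0] root_def)
    then show ?thesis using False by (simp add: act_def transl_def scale_def)
  qed
qed

section \<open>Words, lengths and inversions\<close>

abbreviation adj :: "int \<Rightarrow> int \<Rightarrow> int"
  where "adj i \<equiv> trp i (i + 1)"

lemma not_cg_succ [simp]: "\<not> cg i (i + 1)" "\<not> cg (i + 1) i"
  using not_cg_close[of i "i + 1"] N_ge_3 by (simp_all add: cg_sym[of "i + 1"])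

definition perm_of_word :: "nat list \<Rightarrow> int \<Rightarrow> int"
  where "perm_of_word is = foldr (\<lambda>i w. adj (int i) \<circ> w) is id"

lemma perm_of_word_simps [simp]:
  "perm_of_word [] = id" "perm_of_word (i # is) = adj (int i) \<circ> perm_of_word is"
  by (simp_all add: perm_of_word_def)

lemma perm_of_word_aff: "perm_of_word is \<in> aff"
  by (induction "is") (simp_all add: aff_id aff_comp trp_aff del: o_apply id_apply)

lemma act_adj: "i < n \<Longrightarrow> act (adj (int i)) = reflect n (simple_root i)"
  by (simp add: act_trp simple_root_eq)

lemma word_prod_eq: "set is \<subseteq> {..<n} \<Longrightarrow> word_prod n is = act (perm_of_word is)"
proof (induction "is")
  case Nil
  have "word_prod n [] = id" by (simp add: word_prod_def)
  then show ?case by (metis perm_of_word_simps(1) act_id)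
next
  case (Cons i "is")
  have "word_prod n (i # is) = reflect n (simple_root i) \<circ> word_prod n is"
    by (simp add: word_prod_def)
  with Cons show ?case
    using act_comp[of "adj (int i)" "perm_of_word is"] act_adj[of i]
    by (simp add: trp_aff del: o_apply)
qed

section \<open>The inversion count and its agreement with the length\<close>

definition window_pairs :: "int \<Rightarrow> (int \<times> int) set"
  where "window_pairs p = {(a, b). p \<le> a \<and> a < b \<and> b < p + N}"

text \<open>Shi's floor formula for the length of an affine permutation. The start \<open>p\<close>
  of the window is kept free because the length of the maximal elements is computed in the window
  that begins with the interval of \<open>\<alpha>\<close>.\<close>

definition invs :: "int \<Rightarrow> (int \<Rightarrow> int) \<Rightarrow> int"
  where "invs p w = (\<Sum>(a, b)\<in>window_pairs p. \<bar>(w b - w a) div N\<bar>)"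

lemma finite_window_pairs: "finite (window_pairs p)"
  by (rule finite_subset[of _ "{p..<p+N} \<times> {p..<p+N}"]) (auto simp: window_pairs_def)

lemma invs_nonneg: "0 \<le> invs p w"
  unfolding invs_def by (rule sum_nonneg) auto

lemma invs_id: "invs p id = 0"
proof -
  have "(b - a) div N = 0" if "(a, b) \<in> window_pairs p" for a b
    using that by (simp add: window_pairs_def div_pos_pos_trivial)
  then show ?thesis by (auto simp: invs_def intro!: sum.neutral)
qed

lemma div_succ:
  assumes "\<not> cg (z + 1) 0"
  shows "(z + 1) div N = z div N"
proof -
  have z: "z + 1 = (z mod N + 1) + (z div N) * N" by simp
  have "z mod N + 1 \<noteq> N"
  proof
    assume "z mod N + 1 = N"
    then have "z + 1 = N + (z div N) * N" using z by linarith
    then have "cg (z + 1) N" unfolding cg_iff by blast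
    then have "cg (z + 1) 0" using cg_shift_one(2)[of "z + 1" 0] by simp
    with assms show False by simp
  qed
  then have "z mod N + 1 < N" using pos_mod_bound[OF N_pos, of z] by simp
  then have "(z mod N + 1) div N = 0"
    using pos_mod_sign[OF N_pos, of z] by (intro div_pos_pos_trivial) auto
  have "(z + 1) div N = ((z mod N + 1) + (z div N) * N) div N"
    by (rule arg_cong[OF z])
  also have "\<dots> = z div N"
    unfolding div_shift \<open>(z mod N + 1) div N = 0\<close> by simp
  finally show ?thesis .
qed

lemma cg_diff_0: "cg (a - b) 0 \<longleftrightarrow> cg a b"
  by (simp add: cg_def)

lemma cg_diff_1: "cg (a - b + 1) 0 \<longleftrightarrow> cg (a + 1) b"
  by (simp add: cg_def algebra_simps)

lemma cg_add_1: "cg (a + 1) (b + 1) \<longleftrightarrow> cg a b"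
  by (simp add: cg_def)

text \<open>At most one of the two values moves, and only by one. The quotient could change only by
  the difference entering or leaving a multiple of \<open>n\<close>, which the hypotheses
  exclude.\<close>

lemma adj_div:
  assumes uv: "\<not> cg u v" and *: "\<not> (cg u i \<and> cg v (i + 1))" "\<not> (cg v i \<and> cg u (i + 1))"
  shows "(adj i v - adj i u) div N = (v - u) div N"
proof -
  have up: "(v - u + 1) div N = (v - u) div N" if "\<not> cg (v + 1) u"
    using that by (intro div_succ) (simp add: cg_diff_1)
  have down: "(v - u - 1) div N = (v - u) div N"
    using div_succ[of "v - u - 1"] uv by (simp add: cg_diff_0 cg_sym[of u])
  consider "cg u i" "\<not> cg v i" | "cg u (i + 1)" | "cg v i" "\<not> cg u i" | "cg v (i + 1)"
    | "\<not> cg u i" "\<not> cg u (i + 1)" "\<not> cg v i" "\<not> cg v (i + 1)" | "cg u i" "cg v i" by blast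
  then show ?thesis
  proof cases
    case 1
    then have "adj i v = v" "adj i u = u + 1" using * by (auto simp: trp_def)
    then show ?thesis using down by (simp add: algebra_simps)
  next
    case 2
    have "\<not> cg u i" using 2 not_cg_succ cg_trans cg_sym by blast
    moreover have v: "\<not> cg v (i + 1)" using uv 2 cg_trans cg_sym by blast
    ultimately have "adj i u = u - 1" "adj i v = v" using * 2 by (auto simp: trp_def)
    moreover have "\<not> cg (v + 1) u"
    proof
      assume "cg (v + 1) u"
      then have "cg (v + 1) (i + 1)" using 2 cg_trans by blast
      then show False using * 2 by (simp add: cg_add_1)
    qed
    ultimately have "adj i v - adj i u = v - u + 1" "\<not> cg (v + 1) u" by simp_all
    then show ?thesis using up by simp
  next
    case 3
    then have "adj i v = v + 1" "adj i u = u" using * by (auto simp: trp_def)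
    moreover have "\<not> cg (v + 1) u"
    proof
      assume "cg (v + 1) u"
      moreover have "cg (v + 1) (i + 1)" using 3 by (simp add: cg_add_1)
      ultimately have "cg u (i + 1)" using cg_trans cg_sym by blast
      then show False using * 3 by simp
    qed
    ultimately show ?thesis using up by (simp add: algebra_simps)
  next
    case 4
    have "\<not> cg v i" using 4 not_cg_succ cg_trans cg_sym by blast
    moreover have u: "\<not> cg u (i + 1)" using uv 4 cg_trans cg_sym by blast
    ultimately have "adj i v = v - 1" "adj i u = u" using * 4 by (auto simp: trp_def)
    then have "adj i v - adj i u = v - u - 1" by simp
    then show ?thesis using down by simp
  next
    case 5
    then show ?thesis by (simp add: trp_def)
  next
    case 6
    then show ?thesis using uv cg_trans cg_sym by blast
  qed
qed

text \<open>A single pair of the window carries the classes of \<open>i\<close> and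
  \<open>i + 1\<close>. Its quotient changes by one, and the absolute value grows exactly when
  \<open>i\<close> stands to the left of \<open>i + 1\<close>.\<close>

lemma invs_adj:
  assumes w: "w \<in> aff"
  shows "invs p (adj i \<circ> w) = invs p w + (if pinv w i < pinv w (i + 1) then 1 else -1)"
proof -
  obtain k where k: "p \<le> pinv w i + k * N" "pinv w i + k * N < p + N" by (rule window_rep)
  obtain l where l: "p \<le> pinv w (i + 1) + l * N" "pinv w (i + 1) + l * N < p + N" by (rule window_rep)
  \<comment> \<open>The positions in the window whose values are congruent to \<open>i\<close> and
    \<open>i + 1\<close>.\<close>
  define a b where "a = pinv w i + k * N" and "b = pinv w (i + 1) + l * N"
  have wa: "w a = i + k * N" and wb: "w b = (i + 1) + l * N"
    using w by (simp_all add: a_def b_def aff_shift)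
  have sa: "adj i (w a) = (i + 1) + k * N" and sb: "adj i (w b) = i + l * N"
    by (simp_all add: wa wb trp_def)
  have ab: "a \<noteq> b"
    using wa wb not_cg_succ(1)[of i] by (metis cg_refl cg_shift)
  have less: "pinv w i < pinv w (i + 1) \<longleftrightarrow> (l - k) * N < b - a"
    by (simp add: a_def b_def algebra_simps)
  \<comment> \<open>As \<open>a\<close> and \<open>b\<close> differ by less than \<open>n\<close>,
    the periods \<open>k\<close> and \<open>l\<close> decide, and the order of \<open>a\<close> and
    \<open>b\<close> breaks a tie.\<close>
  have less': "(l - k) * N < b - a \<longleftrightarrow> (if a < b then l \<le> k else l < k)"
  proof -
    have bd: "b - a < N" "a - b < N" using k l by (auto simp: a_def b_def)
    consider "l - k \<le> -1" | "l = k" | "1 \<le> l - k" by linarith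
    then show ?thesis
    proof cases
      case 1
      then have "(l - k) * N \<le> -1 * N" by (intro mult_right_mono) auto
      then show ?thesis using bd 1 by auto
    next
      case 3
      then have "1 * N \<le> (l - k) * N" by (intro mult_right_mono) auto
      then have "\<not> (l - k) * N < b - a" using bd by linarith
      then show ?thesis using 3 by auto
    qed auto
  qed
  have d1: "(1 + m * N) div N = m" "(- 1 + m * N) div N = m - 1" for m
    using div_shift[of 1 m] div_shift[of "-1" m] small_div[of 1] small_div[of "-1"] N_ge_3 by simp_all
  define q where "q = (if a < b then (a, b) else (b, a))"
  have q: "q \<in> window_pairs p"
    using k l ab by (auto simp: q_def window_pairs_def a_def b_def)
  let ?f = "\<lambda>w (a, b). \<bar>(w b - w a) div N\<bar>"
  have rest: "?f (adj i \<circ> w) z = ?f w z" if "z \<in> window_pairs p - {q}" for z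
  proof -
    obtain c d where z: "z = (c, d)" by force
    have cd: "p \<le> c" "c < d" "d < p + N" "(c, d) \<noteq> q" using that by (auto simp: z window_pairs_def)
    have isa: "c' = a" if "cg (w c') i" "p \<le> c'" "c' < p + N" for c'
    proof -
      have "cg (w c') (w a)" using that(1) by (simp add: wa)
      then show ?thesis using that k cg_close[of c' a] w by (auto simp: aff_cg a_def)
    qed
    have isb: "c' = b" if "cg (w c') (i + 1)" "p \<le> c'" "c' < p + N" for c'
    proof -
      have "cg (w c') (w b)" using that(1) by (simp add: wb)
      then show ?thesis using that l cg_close[of c' b] w by (auto simp: aff_cg b_def)
    qed
    have "(adj i (w d) - adj i (w c)) div N = (w d - w c) div N"
    proof (rule adj_div)
      show "\<not> cg (w c) (w d)" using cd w not_cg_close[of c d] by (simp add: aff_cg)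
      show "\<not> (cg (w c) i \<and> cg (w d) (i + 1))"
        using isa[of c] isb[of d] cd by (auto simp: q_def)
      show "\<not> (cg (w d) i \<and> cg (w c) (i + 1))"
        using isa[of d] isb[of c] cd by (auto simp: q_def)
    qed
    then show ?thesis by (simp add: z)
  qed
  have main: "?f (adj i \<circ> w) q = ?f w q + (if pinv w i < pinv w (i + 1) then 1 else -1)"
  proof (cases "a < b")
    case True
    have e: "w b - w a = 1 + (l - k) * N" "adj i (w b) - adj i (w a) = -1 + (l - k) * N"
      unfolding sa sb unfolding wa wb by (simp_all add: algebra_simps)
    show ?thesis unfolding less less' using True e[THEN arg_cong[of _ _ "\<lambda>x. x div N"]]
      unfolding d1 by (simp add: q_def)
  next
    case False
    have e: "w a - w b = -1 + (k - l) * N" "adj i (w a) - adj i (w b) = 1 + (k - l) * N"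
      unfolding sa sb unfolding wa wb by (simp_all add: algebra_simps)
    show ?thesis unfolding less less' using False e[THEN arg_cong[of _ _ "\<lambda>x. x div N"]]
      unfolding d1 by (simp add: q_def)
  qed
  have "invs p (adj i \<circ> w) = ?f (adj i \<circ> w) q + (\<Sum>z\<in>window_pairs p - {q}. ?f (adj i \<circ> w) z)"
    unfolding invs_def by (rule sum.remove[OF finite_window_pairs q])
  also have "(\<Sum>z\<in>window_pairs p - {q}. ?f (adj i \<circ> w) z) = (\<Sum>z\<in>window_pairs p - {q}. ?f w z)"
    by (rule sum.cong[OF refl rest])
  also have "?f (adj i \<circ> w) q + \<dots> = (?f w q + (\<Sum>z\<in>window_pairs p - {q}. ?f w z))
      + (if pinv w i < pinv w (i + 1) then 1 else -1)"
    unfolding main by simp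
  also have "?f w q + (\<Sum>z\<in>window_pairs p - {q}. ?f w z) = invs p w"
    unfolding invs_def by (rule sum.remove[OF finite_window_pairs q, symmetric])
  finally show ?thesis .
qed

text \<open>Strictly increasing values that gain exactly \<open>n\<close> over \<open>n\<close>
  steps must gain one at each step; the sum condition excludes a common shift.\<close>

lemma aff_eq_id:
  assumes w: "w \<in> aff" and up: "\<And>i. w i < w (i + 1)"
  shows "w = id"
proof -
  have mono: "w i + int k \<le> w (i + int k)" for i k
  proof (induction k)
    case (Suc k)
    then show ?case using up[of "i + int k"] by (simp add: algebra_simps)
  qed simp
  have step: "w (i + 1) - (i + 1) = w i - i" for i
    using mono[of "i + 1" "n - 1"] aff_shift_one[OF w, of i] up[of i] n_ge_3
    by (simp add: of_nat_diff)
  have const: "w i - i = w 0" for i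
  proof (induction i rule: int_induct[where k = 0])
    case (step1 i) then show ?case using step[of i] by simp
  next
    case (step2 i) then show ?case using step[of "i - 1"] by simp
  qed simp
  have "(\<Sum>i\<in>{0..<N}. w i - i) = N * w 0"
    by (simp add: const del: sum_subtractf)
  then have "w 0 = 0" using aff_sum[OF w] N_pos by simp
  then show ?thesis using const by (auto simp: fun_eq_iff)
qed

lemma adj_adj_comp: "w \<in> aff \<Longrightarrow> adj i \<circ> (adj i \<circ> w) = w"
  by (simp add: fun_eq_iff trp_trp)

lemma adj_cg: "cg i j \<Longrightarrow> adj i = adj j"
proof -
  assume "cg i j"
  then have "cg c i \<longleftrightarrow> cg c j" "cg c (i + 1) \<longleftrightarrow> cg c (j + 1)" for c
    using cg_trans cg_sym cg_add_1 by blast+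
  then show "adj i = adj j" by (simp add: trp_def fun_eq_iff)
qed

text \<open>While the inverse has a descent, left multiplication by the corresponding generator
  lowers the inversion count by one. An increasing inverse is the identity.\<close>

lemma reduced_word:
  assumes "w \<in> aff"
  shows "\<exists>is. set is \<subseteq> {..<n} \<and> length is = nat (invs p w) \<and> perm_of_word is = w"
  using assms
proof (induction "nat (invs p w)" arbitrary: w rule: less_induct)
  case less
  show ?case
  proof (cases "\<exists>i. \<not> pinv w i < pinv w (i + 1)")
    case True
    then obtain i0 where i0: "\<not> pinv w i0 < pinv w (i0 + 1)" by blast
    let ?w = "adj i0 \<circ> w"
    have w': "?w \<in> aff" using less.prems by (simp add: aff_comp trp_aff)
    have iv: "invs p ?w = invs p w - 1" using invs_adj[OF less.prems, of p i0] i0 by simp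
    then have "nat (invs p ?w) < nat (invs p w)" using invs_nonneg[of p ?w] by simp
    then obtain "is" where "is": "set is \<subseteq> {..<n}" "length is = nat (invs p ?w)" "perm_of_word is = ?w"
      using less.hyps[OF _ w'] by blast
    define i where "i = nat (i0 mod N)"
    have i: "int i = i0 mod N" "i < n" using N_pos by (auto simp: i_def nat_less_iff)
    then have "adj (int i) = adj i0" by (intro adj_cg) simp
    then have "perm_of_word (i # is) = w" using "is" adj_adj_comp[OF less.prems] by simp
    moreover have "length (i # is) = nat (invs p w)" using "is" iv invs_nonneg[of p ?w] by simp
    ultimately show ?thesis using "is" i by (intro exI[of _ "i # is"]) auto
  next
    case False
    then have "pinv w = id" using aff_eq_id[OF aff_inv[OF less.prems]] by blast
    then have "w = id" using inv_inv[OF less.prems] by (metis inv_id)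
    then show ?thesis by (intro exI[of _ "[]"]) (simp add: invs_id)
  qed
qed

lemma invs_word: "invs p (perm_of_word is) \<le> int (length is)"
proof (induction "is")
  case (Cons i "is")
  then show ?case using invs_adj[OF perm_of_word_aff[of "is"], of p "int i"]
    by (simp del: o_apply split: if_splits)
qed (simp add: invs_id del: id_apply)

text \<open>A word with \<open>invs p w\<close> letters exists by \<open>reduced_word\<close>, and
  none is shorter since each letter raises the count by at most one.\<close>

lemma len_act: "w \<in> aff \<Longrightarrow> len n (act w) = nat (invs p w)"
  unfolding len_def
proof (rule Least_equality)
  assume w: "w \<in> aff"
  obtain "is" where "is": "set is \<subseteq> {..<n}" "length is = nat (invs p w)" "perm_of_word is = w"
    using reduced_word[OF w] by blast
  then have "word_prod n is = act w" by (simp add: word_prod_eq)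
  then show "\<exists>is. set is \<subseteq> {..<n} \<and> length is = nat (invs p w) \<and> word_prod n is = act w"
    using "is" by blast
  fix k assume "\<exists>is. set is \<subseteq> {..<n} \<and> length is = k \<and> word_prod n is = act w"
  then obtain "is" where "is": "set is \<subseteq> {..<n}" "length is = k" "word_prod n is = act w" by blast
  then have "perm_of_word is = w" using w
    by (intro act_inject) (simp_all add: word_prod_eq perm_of_word_aff)
  then show "nat (invs p w) \<le> k" using invs_word[of p "is"] "is" by simp
qed

text \<open>Strong exchange: reading the word from the right, some letter first reverses the order of
  the images of \<open>a\<close> and \<open>b\<close>; that letter is deleted.\<close>

lemma strong_exchange:
  assumes "set is \<subseteq> {..<n}" "a < b" "\<not> cg a b" "perm_of_word is b < perm_of_word is a"
  shows "\<exists>js. set js \<subseteq> {..<n} \<and> Suc (length js) = length is \<and> perm_of_word js = perm_of_word is \<circ> trp a b"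
  using assms
proof (induction "is")
  case (Cons i "is")
  let ?u = "perm_of_word is" and ?s = "adj (int i)"
  have u: "?u \<in> aff" by (rule perm_of_word_aff)
  show ?case
  proof (cases "?u b < ?u a")
    case True
    then obtain js where "set js \<subseteq> {..<n}" "Suc (length js) = length is" "perm_of_word js = ?u \<circ> trp a b"
      using Cons.IH[OF _ Cons.prems(2,3) True] Cons.prems(1) by (auto simp del: o_apply)
    then show ?thesis using Cons.prems
      by (intro exI[of _ "i # js"]) (simp add: o_assoc del: o_apply)
  next
    case False
    have ne: "?u a \<noteq> ?u b" using u Cons.prems by (auto simp: aff_inj)
    have flip: "?s (?u b) < ?s (?u a)" using Cons.prems by simp
    have si: "?s c \<in> {c - 1, c, c + 1}" "?s c = c + 1 \<longleftrightarrow> cg c (int i)" for c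
      by (auto simp: trp_def)
    have "?s (?u a) \<noteq> ?u a \<or> ?u a < ?u b - 1"
      using si(1)[of "?u a"] si(1)[of "?u b"] flip False ne
        aff_inj[OF trp_aff[OF not_cg_succ(1)], of "int i" "?u a" "?u b"] by auto
    \<comment> \<open>A letter moves a value by at most one, so a reversal needs adjacent values,
      and the letter is then the transposition of exactly these two.\<close>
    then have 1: "?u b = ?u a + 1" "cg (?u a) (int i)"
      using si(1)[of "?u a"] si(1)[of "?u b"] si(2)[of "?u a"] flip False ne by auto
    then have "?s = trp (?u a) (?u b)" using adj_cg by (metis)
    then have "?s \<circ> ?u = ?u \<circ> trp a b" using trp_conj[OF u, of a b] by simp
    moreover have "?u \<circ> trp a b \<circ> trp a b = ?u"
      using Cons.prems by (simp add: fun_eq_iff trp_trp)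
    ultimately have "perm_of_word is = perm_of_word (i # is) \<circ> trp a b"
      by (simp del: o_apply)
    then show ?thesis using Cons.prems by (intro exI[of _ "is"]) (simp del: perm_of_word_simps)
  qed
qed simp

lemma len_exchange:
  assumes w: "w \<in> aff" and ab: "a < b" "\<not> cg a b" "w b < w a"
  shows "len n (act (w \<circ> trp a b)) < len n (act w)"
proof -
  obtain "is" where "is": "set is \<subseteq> {..<n}" "length is = nat (invs 0 w)" "perm_of_word is = w"
    using reduced_word[OF w] by blast
  then obtain js where js: "set js \<subseteq> {..<n}" "Suc (length js) = length is" "perm_of_word js = w \<circ> trp a b"
    using strong_exchange[of "is" a b] ab by auto
  have "nat (invs 0 (w \<circ> trp a b)) \<le> length js"
    using invs_word[of 0 js] js by simp
  also have "\<dots> < nat (invs 0 w)" using js "is" by simp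
  finally show ?thesis
    using len_act[OF w, of 0] len_act[OF aff_comp[OF w trp_aff[OF ab(2)]], of 0] by simp
qed

lemma len_less:
  assumes w: "w \<in> aff" and ab: "a < b" "\<not> cg a b" "w a < w b"
  shows "len n (act w) < len n (act (w \<circ> trp a b))"
proof -
  have "w \<circ> trp a b \<circ> trp a b = w" using ab by (simp add: fun_eq_iff trp_trp)
  then show ?thesis
    using len_exchange[OF aff_comp[OF w trp_aff[OF ab(2)]] ab(1,2)] ab by (simp add: trp_right)
qed

section \<open>The Weyl group as the image of the affine permutations\<close>

lemma act_bij: "w \<in> aff \<Longrightarrow> bij (act w)"
proof -
  assume w: "w \<in> aff"
  have 1: "w \<circ> pinv w = id" "pinv w \<circ> w = id" using w by (auto simp: fun_eq_iff)
  show "bij (act w)"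
    using act_comp[OF w, of "pinv w"] act_comp[OF aff_inv[OF w], of w] unfolding 1 act_id
    by (metis o_bij)
qed

text \<open>Generators are involutive and come from adjacent transpositions, which settles one
  inclusion by induction on generation; reduced words settle the other.\<close>

lemma Waff_eq: "Waff n = act ` aff"
proof
  let ?S = "{reflect n (simple_root i) | i. i < n}"
  have Bij: "act w \<in> Bij UNIV" if "w \<in> aff" for w
    using act_bij[OF that] by (simp add: Bij_def)
  have mult: "act w \<otimes>\<^bsub>BijGroup UNIV\<^esub> act u = act (w \<circ> u)" if "w \<in> aff" "u \<in> aff" for w u
    using Bij[OF that(1)] Bij[OF that(2)] act_comp[OF that(1), of u]
    by (auto simp: BijGroup_def compose_def fun_eq_iff)
  have one: "\<one>\<^bsub>BijGroup UNIV\<^esub> = act id"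
    by (auto simp: BijGroup_def act_id)
  have S: "\<exists>i. h = act (adj i)" if "h \<in> ?S" for h
  proof -
    from that obtain i where "i < n" "h = reflect n (simple_root i)" by blast
    then have "h = act (adj (int i))" by (simp add: act_adj)
    then show ?thesis by blast
  qed
  have inv_S: "inv\<^bsub>BijGroup UNIV\<^esub> (act (adj i)) = act (adj i)" for i
  proof -
    have "act (adj i) \<circ> act (adj i) = id"
      using act_comp[of "adj i" "adj i"] trp_trp[of i "i + 1"] act_id
      by (simp add: trp_aff o_def id_def)
    then have "inv_into UNIV (act (adj i)) = act (adj i)"
      by (intro inv_unique_comp) auto
    then show ?thesis using inv_BijGroup[OF Bij[of "adj i"]] by (simp add: trp_aff restrict_def)
  qed
  show "Waff n \<subseteq> act ` aff"
  proof
    fix g assume "g \<in> Waff n"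
    then show "g \<in> act ` aff" unfolding Waff_def
    proof (induction rule: generate.induct)
      case one then show ?case using \<open>\<one>\<^bsub>BijGroup UNIV\<^esub> = act id\<close> aff_id by auto
    next
      case (incl h) then show ?case using S[of h] by (auto simp: trp_aff)
    next
      case (inv h)
      then obtain i where "h = act (adj i)" using S by blast
      then show ?case using inv_S[of i] trp_aff[OF not_cg_succ(1)] by simp
    next
      case (eng g h)
      then obtain w u where "w \<in> aff" "u \<in> aff" "g = act w" "h = act u" by blast
      then show ?case using mult[of w u] aff_comp[of w u] by auto
    qed
  qed
  have "act (perm_of_word is) \<in> Waff n" if "set is \<subseteq> {..<n}" for "is"
    using that unfolding Waff_def
  proof (induction "is")
    case Nil then show ?case
      using generate.one[of "BijGroup UNIV" ?S] by (simp add: one del: id_apply)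
  next
    case (Cons i "is")
    have "act (adj (int i)) \<in> ?S" using Cons.prems act_adj[of i] by fastforce
    then have "act (adj (int i)) \<in> generate (BijGroup UNIV) ?S"
      by (rule generate.incl)
    moreover have "act (perm_of_word is) \<in> generate (BijGroup UNIV) ?S" using Cons by simp
    ultimately have "act (adj (int i)) \<otimes>\<^bsub>BijGroup UNIV\<^esub> act (perm_of_word is)
        \<in> generate (BijGroup UNIV) ?S"
      by (rule generate.eng)
    then show ?case
      using mult[of "adj (int i)" "perm_of_word is"]
      by (simp add: trp_aff perm_of_word_aff del: o_apply)
  qed
  then show "act ` aff \<subseteq> Waff n"
    using reduced_word by blast
qed

section \<open>Displacements and reachability\<close>

text \<open>For each residue \<open>j\<close>, \<open>disp w j\<close> counts the integers \<open>c \<le> j\<close> with \<open>j < w c\<close>.\<close>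

definition disp :: "(int \<Rightarrow> int) \<Rightarrow> int \<Rightarrow> int"
  where "disp w j = (\<Sum>c\<in>{0..<N}. max 0 (arc c (w c) j))"

lemma disp_window: "w \<in> aff \<Longrightarrow> disp w j = (\<Sum>c\<in>{x..<x+N}. max 0 (arc c (w c) j))"
  using sum_window[of "\<lambda>c. max 0 (arc c (w c) j)" 0 x] by (simp add: disp_def aff_shift_one)

lemma disp_index: "cg i j \<Longrightarrow> disp w i = disp w j"
  by (simp add: disp_def arc_cg)

lemma disp_ge:
  assumes "w \<in> aff"
  shows "max 0 (arc a (w a) j) \<le> disp w j"
proof -
  have "a \<in> {a..<a+N}" using N_pos by simp
  then show ?thesis unfolding disp_window[OF assms, of j a]
    by (intro member_le_sum) auto
qed

lemma disp_nonneg: "0 \<le> disp w j"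
  unfolding disp_def by (rule sum_nonneg) simp

text \<open>\<open>n\<close> times an arc count is the displacement minus a difference of
  remainders. Over one period the displacements sum to zero and the remainders are merely
  permuted.\<close>

lemma sum_arc_aff:
  assumes w: "w \<in> aff"
  shows "(\<Sum>c\<in>{0..<N}. arc c (w c) j) = 0"
proof -
  let ?m = "\<lambda>c. (c - 1 - j) mod N"
  have e: "N * arc c d j = (d - c) - (?m d - ?m c)" for c d
    using mult_div_mod_eq[of N "c - 1 - j"] mult_div_mod_eq[of N "d - 1 - j"]
    unfolding arc_def right_diff_distrib by linarith
  have per: "?m (i + N) = ?m i" for i
    using mod_add_self2[of "i - 1 - j" N] by (simp add: algebra_simps)
  have "(\<Sum>c\<in>{0..<0+N}. ?m (w c)) = (\<Sum>c\<in>{0..<0+N}. ?m c)"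
    by (rule sum_reindex_window[of w ?m]) (simp_all add: w aff_bij aff_shift_one per)
  moreover have "N * (\<Sum>c\<in>{0..<N}. arc c (w c) j)
      = (\<Sum>c\<in>{0..<N}. w c - c) - ((\<Sum>c\<in>{0..<N}. ?m (w c)) - (\<Sum>c\<in>{0..<N}. ?m c))"
    by (simp add: sum_distrib_left e sum_subtractf)
  ultimately have "N * (\<Sum>c\<in>{0..<N}. arc c (w c) j) = 0"
    using aff_sum[OF w] by simp
  then show ?thesis using N_pos by simp
qed

text \<open>By \<open>sum_arc_aff\<close>, each point is passed upwards as often as downwards, and
  inversion exchanges the two directions.\<close>

lemma disp_inv:
  assumes w: "w \<in> aff"
  shows "disp (pinv w) j = disp w j"
proof -
  let ?f = "\<lambda>c. max 0 (arc c (pinv w c) j)"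
  have "disp (pinv w) j = (\<Sum>c\<in>{0..<0+N}. ?f c)" by (simp add: disp_def)
  also have "\<dots> = (\<Sum>c\<in>{0..<0+N}. ?f (w c))"
    by (rule sum_reindex_window[symmetric])
      (simp_all add: w aff_bij aff_shift_one aff_inv)
  also have "\<dots> = (\<Sum>c\<in>{0..<N}. max 0 (arc c (w c) j) - arc c (w c) j)"
    using w by (intro sum.cong) (auto simp: arc_swap[of "w _"])
  also have "\<dots> = disp w j"
    by (simp add: sum_subtractf disp_def sum_arc_aff[OF w])
  finally show ?thesis .
qed

text \<open>Only the classes of \<open>a\<close> and \<open>b\<close> contribute to the change, and
  their contributions combine to the part common to \<open>[a, b)\<close> and
  \<open>[w a, w b)\<close>.\<close>

lemma disp_trp:
  assumes w: "w \<in> aff" and ab: "a < b" "\<not> cg a b" "w a < w b"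
  shows "disp (w \<circ> trp a b) j = disp w j + max 0 (arc (max a (w a)) (min b (w b)) j)"
proof -
  let ?t = "trp a b"
  have t: "?t \<in> aff" using ab by (simp add: trp_aff)
  define h where "h c = max 0 (arc c (w (?t c)) j) - max 0 (arc c (w c) j)" for c
  have per: "h (c + N) = h c" for c
    using w by (simp add: h_def aff_shift_one trp_shift_one)
  have "h c = ind c a * h c + ind c b * h c" for c
    using ab cg_trans[of a c b] cg_sym[of a c] trp_cg(3)[of c a b] by (auto simp: ind_def h_def)
  then have "(\<Sum>c\<in>{0..<0+N}. h c) = (\<Sum>c\<in>{0..<0+N}. ind c a * h c) + (\<Sum>c\<in>{0..<0+N}. ind c b * h c)"
    by (subst sum.distrib[symmetric]) (rule sum.cong[OF refl])
  then have "disp (w \<circ> ?t) j - disp w j = h a + h b"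
    unfolding sum_ind[of h, OF per] by (simp add: disp_def h_def sum_subtractf)
  moreover have "h a + h b = max 0 (arc (max a (w a)) (min b (w b)) j)"
  proof -
    \<comment> \<open>A monotone potential commutes with \<open>max\<close> and \<open>min\<close>,
      so the claim becomes an identity between four ordered numbers.\<close>
    define G where "G c = (c - 1 - j) div N" for c
    have arc: "arc c d j = G d - G c" for c d by (simp add: arc_def G_def)
    have mono: "c \<le> d \<Longrightarrow> G c \<le> G d" for c d using N_pos by (simp add: G_def zdiv_mono1)
    have mx: "G (max c d) = max (G c) (G d)" "G (min c d) = min (G c) (G d)" for c d
      using mono[of c d] mono[of d c] by (auto simp: max_def min_def)
    show ?thesis
      using mono[of a b] mono[of "w a" "w b"] ab
      unfolding h_def arc mx by (simp add: trp_right max_def min_def)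
  qed
  ultimately show ?thesis by simp
qed

section \<open>Sorting an affine permutation\<close>

lemma exists_up:
  assumes w: "w \<in> aff" and "w \<noteq> id"
  shows "\<exists>c. c < w c"
proof (rule ccontr)
  assume "\<not> ?thesis"
  then have le: "w c \<le> c" for c by (meson not_less)
  have "w c = c" if "c \<in> {0..<N}" for c
  proof -
    have "(\<Sum>c\<in>{0..<N}. c - w c) = 0"
      using aff_sum[OF w] by (simp add: sum_subtractf)
    then show ?thesis
      using sum_nonneg_eq_0_iff[of "{0..<N}" "\<lambda>c. c - w c"] le that by auto
  qed
  then have "w c - c = 0" for c
    using periodic_cg[of "\<lambda>c. w c - c" "c mod N" c] aff_shift_one[OF w] N_pos by auto
  then show False using \<open>w \<noteq> id\<close> by (auto simp: fun_eq_iff)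
qed

lemma exists_down:
  assumes w: "w \<in> aff" and "w \<noteq> id"
  shows "\<exists>c. w c < c"
proof -
  have "pinv w \<noteq> id" using assms by (metis inv_inv inv_id)
  then obtain c where "c < pinv w c" using exists_up[OF aff_inv[OF w]] by blast
  then have "w (pinv w c) < pinv w c" using w by simp
  then show ?thesis by blast
qed

text \<open>Take an up position \<open>a\<close> and a down position \<open>b > a\<close> with only fixed points between them:
  by injectivity neither \<open>w a\<close> nor \<open>w b\<close> lies strictly between \<open>a\<close> and \<open>b\<close>.\<close>

lemma crossing_pair:
  assumes w: "w \<in> aff" and ne: "w \<noteq> id"
  obtains a b where "a < b" "\<not> cg a b" "b \<le> w a" "w b \<le> a"
proof -
  obtain c where c: "c < w c" using exists_up[OF assms] by blast
  obtain e0 where e0: "w e0 < e0" using exists_down[OF assms] by blast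
  obtain k where "c \<le> e0 + k * N" by (rule window_rep)
  then have "\<exists>l. w (c + int l) < c + int l"
    using e0 aff_shift[OF w, of e0 k] by (intro exI[of _ "nat (e0 + k * N - c)"]) simp
  \<comment> \<open>First comes the nearest down position \<open>b\<close> to the right of
    \<open>c\<close>, then, walking back from it, the nearest up position \<open>a\<close>;
    everything between them is fixed.\<close>
  then obtain l where l: "w (c + int l) < c + int l"
    and lmin: "\<And>l'. l' < l \<Longrightarrow> \<not> w (c + int l') < c + int l'"
    using exists_least_iff[of "\<lambda>l. w (c + int l) < c + int l"] by blast
  define b where "b = c + int l"
  have "\<exists>l. w (b - int l) > b - int l" using c by (intro exI[of _ l]) (simp add: b_def)
  then obtain l2 where l2: "w (b - int l2) > b - int l2"
    and l2min: "\<And>l'. l' < l2 \<Longrightarrow> \<not> w (b - int l') > b - int l'"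
    using exists_least_iff[of "\<lambda>l. w (b - int l) > b - int l"] by blast
  define a where "a = b - int l2"
  have wb: "w b < b" and wa: "a < w a" using l l2 by (simp_all add: a_def b_def)
  have "l2 \<le> l" using l2min[of l] c by (intro leI) (auto simp: b_def)
  then have ca: "c \<le> a" by (simp add: a_def b_def)
  have ab: "a < b" using wa wb by (cases "l2 = 0") (auto simp: a_def)
  have fixed: "w i = i" if "a < i" "i < b" for i
  proof -
    have "nat (i - c) < l" "nat (b - i) < l2" "c \<le> i"
      using that ca by (auto simp: a_def b_def)
    then show ?thesis
      using lmin[of "nat (i - c)"] l2min[of "nat (b - i)"] that by simp
  qed
  have "b \<le> w a"
    using fixed[of "w a"] wa aff_inj[OF w, of "w a" a] by linarith
  moreover have "w b \<le> a"
    using fixed[of "w b"] wb aff_inj[OF w, of "w b" b] by linarith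
  moreover have "\<not> cg a b"
    using wa wb aff_shift[OF w, of b] by (auto simp: cg_iff)
  ultimately show thesis using ab that by blast
qed

definition dispv :: "(int \<Rightarrow> int) \<Rightarrow> rvec"
  where "dispv w = (\<lambda>j. if j < n then disp w (int j) else 0)"

lemma disp_id: "disp id j = 0"
  by (simp add: disp_def)

lemma dispv_id: "dispv id = 0"
  by (auto simp: dispv_def disp_id)

lemma id_Waff: "id \<in> Waff n"
  unfolding Waff_eq using aff_id(2) act_id by (metis imageI)

text \<open>At a crossing pair the overlap in \<open>disp_trp\<close> is all of
  \<open>[a, b)\<close>, so undoing the exchange lowers the displacement vector by exactly
  \<open>root a b\<close>, the degree of one edge. The induction is on the total
  displacement.\<close>

lemma chain_act:
  assumes "w \<in> aff"
  shows "chain n id (dispv w) (act w)"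
  using assms
proof (induction "nat (\<Sum>j\<in>{0..<N}. disp w j)" arbitrary: w rule: less_induct)
  case less
  show ?case
  proof (cases "w = id")
    case True
    then show ?thesis using chain.empty[OF id_Waff] by (simp only: dispv_id act_id)
  next
    case False
    obtain a b where ab: "a < b" "\<not> cg a b" "b \<le> w a" "w b \<le> a"
      using crossing_pair[OF less.prems False] .
    define u where "u = w \<circ> trp a b"
    have u: "u \<in> aff" using less.prems ab by (simp add: u_def aff_comp trp_aff)
    have uab: "u a = w b" "u b = w a" using ab by (simp_all add: u_def trp_right)
    have w: "w = u \<circ> trp a b" using ab by (simp add: u_def fun_eq_iff trp_trp)
    have d: "disp w j = disp u j + arc a b j" for j
      using disp_trp[OF u ab(1,2), of j] ab arc_nonneg[of a b j] uab
      by (simp add: w[symmetric] max_def min_def)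
    have "(\<Sum>j\<in>{0..<N}. disp w j) = (\<Sum>j\<in>{0..<N}. disp u j) + (b - a)"
      by (simp add: d sum.distrib sum_arc)
    moreover have "0 \<le> (\<Sum>j\<in>{0..<N}. disp u j)" by (simp add: sum_nonneg disp_nonneg)
    ultimately have "chain n id (dispv u) (act u)"
      using less.hyps[OF _ u] ab by simp
    moreover have "root a b \<in> pos_real_roots n" using ab by (auto simp: pos_real_roots_eq)
    ultimately have "chain n id (dispv u + root a b) (act u \<circ> reflect n (root a b))"
      by (rule chain.edge)
    moreover have "dispv u + root a b = dispv w"
      by (auto simp: dispv_def root_def d)
    moreover have "act u \<circ> reflect n (root a b) = act w"
      using act_comp[OF u, of "trp a b"] act_trp[OF ab(2)] w by simp
    ultimately show ?thesis by simp
  qed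
qed

text \<open>If the values at \<open>a\<close> and \<open>b\<close> increase, the added overlap lies
  inside \<open>[a, b)\<close>. Otherwise the exchange undoes an increase and adds nothing.\<close>

lemma disp_comp_trp_le:
  assumes w: "w \<in> aff" and ab: "a < b" "\<not> cg a b"
  shows "disp (w \<circ> trp a b) j \<le> disp w j + arc a b j"
proof (cases "w a < w b")
  case True
  have "arc (max a (w a)) (min b (w b)) j \<le> arc a b j"
    using arc_nonneg[of a "max a (w a)" j] arc_nonneg[of "min b (w b)" b j]
      arc_add[of a "max a (w a)" j "min b (w b)"] arc_add[of a "min b (w b)" j b] by simp
  then show ?thesis using disp_trp[OF w ab True, of j] arc_nonneg[of a b j] ab by simp
next
  case False
  let ?u = "w \<circ> trp a b"
  have "?u \<in> aff" using w ab by (simp add: aff_comp trp_aff)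
  moreover have "?u a < ?u b" using False ab aff_inj[OF w, of a b] by (simp add: trp_right)
  ultimately have "disp (?u \<circ> trp a b) j \<ge> disp ?u j"
    using disp_trp[OF _ ab, of ?u j] by linarith
  moreover have "?u \<circ> trp a b = w" using ab by (simp add: fun_eq_iff trp_trp)
  ultimately show ?thesis using arc_nonneg[of a b j] ab by simp
qed

lemma chain_dispv:
  assumes "chain n id e v"
  shows "\<exists>w\<in>aff. v = act w \<and> dispv w \<le> e"
  using assms
proof induction
  case empty
  show ?case using aff_id(2) by (intro bexI[of _ id]) (simp_all only: act_id dispv_id order_refl simp_thms)
next
  case (edge e v \<beta>)
  then obtain w where w: "w \<in> aff" "v = act w" "dispv w \<le> e" by blast
  obtain a b where ab: "a < b" "\<not> cg a b" "\<beta> = root a b"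
    using edge.hyps by (auto simp: pos_real_roots_eq)
  have "v \<circ> reflect n \<beta> = act (w \<circ> trp a b)"
    using w ab act_comp[of w] by (simp add: act_trp)
  moreover have "dispv (w \<circ> trp a b) \<le> e + \<beta>"
  proof (rule le_funI)
    fix j
    show "dispv (w \<circ> trp a b) j \<le> (e + \<beta>) j"
      using disp_comp_trp_le[OF w(1) ab(1,2), of "int j"] w(3)[THEN le_funD, of j] ab
      by (simp add: dispv_def root_def split: if_splits)
  qed
  ultimately show ?case using w ab by (blast intro: aff_comp trp_aff)
qed

lemma bruhat_le_id: "bruhat_le n u id \<Longrightarrow> u = id"
proof -
  assume "bruhat_le n u id"
  then have "(bruhat_step n)\<^sup>*\<^sup>* u id" by (simp add: bruhat_le_def)
  moreover have "len n id = 0"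
    using len_act[OF aff_id(2), of 0] act_id by (simp add: invs_id)
  ultimately show ?thesis
    by (cases rule: rtranclp.cases) (auto simp: bruhat_step_def)
qed

lemma bruhat_le_len:
  assumes "bruhat_le n u v"
  shows "u = v \<or> len n u < len n v"
proof -
  have "(bruhat_step n)\<^sup>*\<^sup>* u v" using assms by (simp add: bruhat_le_def)
  then show ?thesis by induction (auto simp: bruhat_step_def)
qed

text \<open>Only the identity lies below the identity, and \<open>dispv w\<close> is the least
  degree of a chain from it to \<open>act w\<close>: \<open>chain_act\<close> attains it and
  \<open>chain_dispv\<close> bounds it from below.\<close>

lemma reachable_id: "reachable n d id = {act w | w. w \<in> aff \<and> dispv w \<le> d}"
proof (intro subset_antisym subsetI)
  fix v assume "v \<in> reachable n d id"
  then obtain u e where "bruhat_le n u id" "e \<le> d" "chain n u e v"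
    by (auto simp: reachable_def)
  then show "v \<in> {act w | w. w \<in> aff \<and> dispv w \<le> d}"
    using bruhat_le_id[of u] chain_dispv[of e v] order_trans by blast
next
  fix v assume "v \<in> {act w | w. w \<in> aff \<and> dispv w \<le> d}"
  then obtain w where w: "v = act w" "w \<in> aff" "dispv w \<le> d" by blast
  moreover have "bruhat_le n id id"
    using id_Waff by (simp add: bruhat_le_def)
  ultimately show "v \<in> reachable n d id"
    using chain_act[OF w(2)] by (auto simp: reachable_def Waff_eq)
qed

lemma ind_bounds: "0 \<le> ind c a" "ind c a \<le> 1"
  by (simp_all add: ind_def)

text \<open>Only the class of \<open>x\<close> moves up, and its \<open>m\<close> full turns pass
  every residue \<open>m\<close> times.\<close>

lemma disp_shf:
  assumes "0 \<le> m" "\<not> cg x y"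
  shows "disp (shf m x y) j = m"
proof -
  have "max 0 (arc c (shf m x y c) j) = ind c x * m" for c
  proof -
    have "arc c (shf m x y c) j = m * (ind c x - ind c y)"
      using arc_full[of c "m * (ind c x - ind c y)" j] by (simp add: shf_def algebra_simps)
    moreover have "ind c x = 0 \<or> ind c y = 0"
      using assms(2) cg_common'[of c x y] by (auto simp: ind_def)
    ultimately show ?thesis using assms(1) by (auto simp: ind_def)
  qed
  then have "disp (shf m x y) j = (\<Sum>c\<in>{0..<0+N}. ind c x * m)"
    by (simp add: disp_def)
  also have "\<dots> = m" by (rule sum_ind) simp
  finally show ?thesis .
qed

text \<open>Each of the \<open>n\<close> positions belongs to \<open>n - 1\<close> pairs.\<close>

lemma sum_window_pairs:
  "(\<Sum>(a, b)\<in>window_pairs p. g a + g b) = (N - 1) * (\<Sum>a\<in>{p..<p+N}. g a :: int)"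
proof -
  have 1: "(\<Sum>(a, b)\<in>window_pairs p. g a) = (\<Sum>a\<in>{p..<p+N}. (p + N - 1 - a) * g a)"
  proof -
    have "window_pairs p = (SIGMA a:{p..<p+N}. {a+1..<p+N})"
      by (auto simp: window_pairs_def)
    then have "(\<Sum>(a, b)\<in>window_pairs p. g a) = (\<Sum>a\<in>{p..<p+N}. \<Sum>b\<in>{a+1..<p+N}. g a)"
      using sum.Sigma[of "{p..<p+N}" "\<lambda>a. {a+1..<p+N}" "\<lambda>a b. g a"] by simp
    then show ?thesis by (simp add: algebra_simps)
  qed
  have 2: "(\<Sum>(a, b)\<in>window_pairs p. g b) = (\<Sum>b\<in>{p..<p+N}. (b - p) * g b)"
  proof -
    have "(\<Sum>(a, b)\<in>window_pairs p. g b) = (\<Sum>(b, a)\<in>(SIGMA b:{p..<p+N}. {p..<b}). g b)"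
      by (rule sum.reindex_bij_witness[where i = prod.swap and j = prod.swap])
        (auto simp: window_pairs_def)
    also have "\<dots> = (\<Sum>b\<in>{p..<p+N}. \<Sum>a\<in>{p..<b}. g b)"
      using sum.Sigma[of "{p..<p+N}" "\<lambda>b. {p..<b}" "\<lambda>b a. g b"] by simp
    finally show ?thesis by simp
  qed
  have "(\<Sum>(a, b)\<in>window_pairs p. g a + g b)
      = (\<Sum>(a, b)\<in>window_pairs p. g a) + (\<Sum>(a, b)\<in>window_pairs p. g b)"
    by (simp add: case_prod_unfold sum.distrib)
  also have "\<dots> = (\<Sum>a\<in>{p..<p+N}. (N - 1) * g a)"
    unfolding 1 2 sum.distrib[symmetric] by (intro sum.cong refl) (simp add: algebra_simps)
  finally show ?thesis by (simp add: sum_distrib_left)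
qed

lemma abs_div_le:
  assumes "\<bar>z\<bar> \<le> K * N"
  shows "\<bar>z div N\<bar> \<le> K"
proof -
  have "z \<le> 0 + K * N" "0 + (- K) * N \<le> z" using assms by (simp_all add: abs_le_iff)
  then have "z div N \<le> (0 + K * N) div N" "(0 + (- K) * N) div N \<le> z div N"
    using N_pos by (intro zdiv_mono1; simp)+
  then show ?thesis unfolding div_shift by simp
qed

end

section \<open>Elements that no reflection lengthens\<close>

text \<open>\<open>\<alpha>\<close> is the root of \<open>[p, q)\<close>, and an interval shorter
  than \<open>n\<close> is what \<open>\<alpha> < cc n\<close> means. The degree under study is
  \<open>m *\<^sub>Z cc n + root p q\<close>.\<close>

locale interval_degree = affine_type_A +
  fixes m p q :: int
  assumes m_pos: "1 \<le> m" and pq: "p < q" "q < p + int n"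
begin

definition admissible :: "(int \<Rightarrow> int) \<Rightarrow> bool"
  where "admissible w \<longleftrightarrow> w \<in> aff \<and> (\<forall>j. disp w j \<le> m + arc p q j)"

definition locally_maximal :: "(int \<Rightarrow> int) \<Rightarrow> bool"
  where "locally_maximal w \<longleftrightarrow> admissible w \<and>
    (\<forall>a b. a < b \<longrightarrow> \<not> cg a b \<longrightarrow> w a < w b \<longrightarrow> \<not> admissible (w \<circ> trp a b))"

lemma admissible_inv: "admissible w \<Longrightarrow> admissible (pinv w)"
  by (simp add: admissible_def disp_inv aff_inv)

text \<open>Inversion preserves displacements and turns exchanges of positions into exchanges of
  values. Statements about upward arcs thereby transfer to downward arcs.\<close>

lemma locally_maximal_inv:
  assumes "locally_maximal w"
  shows "locally_maximal (pinv w)"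
  unfolding locally_maximal_def
proof (intro conjI allI impI)
  have w: "w \<in> aff" "admissible w" using assms by (simp_all add: locally_maximal_def admissible_def)
  then show "admissible (pinv w)" by (simp add: admissible_inv)
  fix a b assume ab: "a < b" "\<not> cg a b" "pinv w a < pinv w b"
  let ?c = "pinv w a" and ?d = "pinv w b"
  have cd: "\<not> cg ?c ?d" using ab aff_cg[OF aff_inv[OF w(1)]] by simp
  have "trp a b \<circ> trp a b = id" using ab by (simp add: fun_eq_iff trp_trp)
  then have "pinv (trp a b) = trp a b" by (intro inv_unique_comp)
  then have "pinv (pinv w \<circ> trp a b) = trp a b \<circ> w"
    using w ab by (simp add: o_inv_distrib aff_bij aff_inv trp_aff)
  also have "\<dots> = w \<circ> trp ?c ?d" using trp_conj[OF w(1), of ?c ?d] w by simp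
  finally have "pinv (pinv w \<circ> trp a b) = w \<circ> trp ?c ?d" .
  moreover have "\<not> admissible (w \<circ> trp ?c ?d)"
    using assms ab cd w by (simp add: locally_maximal_def)
  ultimately show "\<not> admissible (pinv w \<circ> trp a b)"
    using admissible_inv by metis
qed

text \<open>An exchange with empty overlap leaves all displacements unchanged and would therefore be
  admissible.\<close>

lemma overlap:
  assumes "locally_maximal w" and ab: "a < b" "\<not> cg a b" "w a < w b"
  shows "w a < b \<and> a < w b"
proof (rule ccontr)
  have w: "w \<in> aff" "admissible w" and not: "\<not> admissible (w \<circ> trp a b)"
    using assms by (simp_all add: locally_maximal_def admissible_def)
  assume "\<not> (w a < b \<and> a < w b)"
  then have "min b (w b) \<le> max a (w a)" by auto
  then have "arc (max a (w a)) (min b (w b)) j \<le> 0" for j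
    using arc_nonneg arc_swap[of "max a (w a)"] by (metis neg_le_0_iff_le)
  then have "disp (w \<circ> trp a b) j = disp w j" for j
    using disp_trp[OF w(1) ab, of j] by simp
  then show False using not w ab by (simp add: admissible_def aff_comp trp_aff)
qed

lemma saturated:
  assumes "locally_maximal w" and ab: "a < b" "\<not> cg a b" "w a < w b"
    and i: "max a (w a) = i" "min b (w b) = i + 1"
  shows "disp w i = m + arc p q i"
proof (rule ccontr)
  have w: "w \<in> aff" "admissible w" and not: "\<not> admissible (w \<circ> trp a b)"
    using assms by (simp_all add: locally_maximal_def admissible_def)
  assume "disp w i \<noteq> m + arc p q i"
  then have less: "disp w i + 1 \<le> m + arc p q i"
    using w(2) by (auto simp: admissible_def add1_zle_eq order_less_le)
  have "disp (w \<circ> trp a b) j \<le> m + arc p q j" for j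
  proof (cases "cg j i")
    case True
    then show ?thesis
      using disp_trp[OF w(1) ab, of j] less disp_index[OF True] arc_cg[OF True, of p q]
      by (simp add: i arc_one)
  next
    case False
    then show ?thesis
      using disp_trp[OF w(1) ab, of j] w(2) by (simp add: i arc_one admissible_def)
  qed
  then show False using not w ab by (simp add: admissible_def aff_comp trp_aff)
qed

text \<open>If all arcs were shorter than \<open>n\<close>, the end point \<open>i\<close> of one
  with the largest displacement would be covered by no arc, whereas \<open>saturated\<close> makes
  the displacement there at least \<open>m\<close>.\<close>

lemma exists_long_up:
  assumes lm: "locally_maximal w"
  shows "\<exists>x. x + N \<le> w x"
proof (rule ccontr)
  have w: "w \<in> aff" using lm by (simp add: locally_maximal_def admissible_def)
  assume "\<not> ?thesis"
  then have short: "w x < x + N" for x by (meson not_le)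
  obtain a where amax: "\<And>b. w b - b \<le> w a - a"
  proof -
    let ?f = "\<lambda>b. w b - b"
    have fin: "finite (?f ` {0..<N})" "?f ` {0..<N} \<noteq> {}" using N_pos by auto
    obtain a where a: "a \<in> {0..<N}" "?f a = Max (?f ` {0..<N})"
      using Max_in[OF fin] by (metis (mono_tags, lifting) image_iff)
    have "?f b \<le> ?f a" for b
    proof -
      have "?f b = ?f (b mod N)"
        by (rule periodic_cg[of ?f]) (simp_all add: aff_shift_one[OF w])
      also have "\<dots> \<le> ?f a" unfolding a(2) using N_pos fin by (intro Max_ge) auto
      finally show ?thesis .
    qed
    then show thesis by (rule that)
  qed
  define i where "i = w a"
  \<comment> \<open>A covering arc that starts before \<open>a\<close> would be longer than that of
    \<open>a\<close>; one that starts after \<open>a\<close> contradicts \<open>overlap\<close>; a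
    translate of the arc of \<open>a\<close> starts too far to the right.\<close>
  have no_cover: "\<not> (b \<le> i \<and> i < w b)" for b
  proof
    assume b: "b \<le> i \<and> i < w b"
    show False
    proof (cases "cg b a")
      case True
      then obtain k where k: "b = a + k * N" by (auto simp: cg_iff)
      then have "0 < k * N" using b aff_shift[OF w, of a k] by (simp add: i_def)
      then have "1 * N \<le> k * N" using N_pos by (intro mult_right_mono) (auto simp: zero_less_mult_iff)
      then show False using b k short[of a] by (simp add: i_def)
    next
      case False
      then show False
        using b amax[of b] overlap[OF lm, of a b] cg_sym[of a b]
        by (cases "b < a") (auto simp: i_def not_less le_less)
    qed
  qed
  have disp0: "disp w i = 0"
  proof -
    have "max 0 (arc b (w b) i) = 0" for b
    proof (rule ccontr)
      assume "\<not> ?thesis"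
      then have "0 < arc b (w b) i" by simp
      then obtain k where "b \<le> i + k * N" "i + k * N < w b" by (rule arc_pos)
      then show False using no_cover[of "b + (- k) * N"] unfolding aff_shift[OF w] by simp
    qed
    then show ?thesis by (simp add: disp_def)
  qed
  have 1: "w i \<le> i" using no_cover[of i] by simp
  \<comment> \<open>Otherwise a downward arc would pass \<open>i\<close>, giving the inverse, hence
    \<open>w\<close>, a positive displacement there.\<close>
  have 2: "i < w (i + 1)"
  proof (rule ccontr)
    assume "\<not> i < w (i + 1)"
    then have "1 \<le> arc (w (i + 1)) (i + 1) i" by (intro arc_ge_1) auto
    then show False
      using disp_ge[OF aff_inv[OF w], of "w (i + 1)" i] disp_inv[OF w, of i] disp0 w by simp
  qed
  have "disp w i = m + arc p q i"
    using 1 2 by (intro saturated[OF lm, of i "i + 1"]) auto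
  then show False using disp0 m_pos arc_nonneg[of p q i] pq by simp
qed

definition cov :: "(int \<Rightarrow> int) \<Rightarrow> int \<Rightarrow> int \<Rightarrow> int"
  where "cov w b i = (if b \<le> i \<and> i < w b then 1 else 0)"

lemma arc_pq: "p \<le> i \<Longrightarrow> i < p + N \<Longrightarrow> arc p q i = (if i < q then 1 else 0)"
  using arc_window[of p i p q] pq by simp

text \<open>A long arc is moved to start in \<open>(p - n, p]\<close>. \<open>overlap\<close> keeps
  the arcs starting strictly inside \<open>(x, x + n)\<close> below \<open>x + n\<close>, so only
  full turns of the long arc pass \<open>x - 1\<close>, and saturation there counts these
  turns.\<close>

lemma long_up:
  assumes lm: "locally_maximal w"
  obtains x s where "q - N < x" "x \<le> p" "0 \<le> s" "s < N" "w x = x + m * N + s"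
    "\<And>b. x < b \<Longrightarrow> b < x + N \<Longrightarrow> w b < x + N"
    "\<And>i. x \<le> i \<Longrightarrow> i < x + N \<Longrightarrow>
      disp w i = m + (if i < x + s then 1 else 0) + (\<Sum>b\<in>{x+1..<x+N}. cov w b i)"
proof -
  have w: "w \<in> aff" and adm: "\<And>j. disp w j \<le> m + arc p q j"
    using lm by (simp_all add: locally_maximal_def admissible_def)
  obtain x0 where x0: "x0 + N \<le> w x0" using exists_long_up[OF lm] by blast
  obtain k0 where k0: "p - N + 1 \<le> x0 + k0 * N" "x0 + k0 * N < p - N + 1 + N"
    by (rule window_rep)
  define x where "x = x0 + k0 * N"
  have x: "x + N \<le> w x" "p - N < x" "x \<le> p"
    using x0 k0 aff_shift[OF w, of x0 k0] by (simp_all add: x_def)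
  \<comment> \<open>A value above \<open>w x\<close> would contradict \<open>overlap\<close> with
    \<open>x\<close>, because \<open>w x\<close> is beyond \<open>b\<close>. So it is smaller, and
    \<open>overlap\<close> with \<open>x + N\<close> gives the bound.\<close>
  have low: "w b < x + N" if b: "x < b" "b < x + N" for b
  proof -
    have c: "\<not> cg x b" using not_cg_close[OF b] .
    then have "w b < w x"
      using overlap[OF lm b(1) c] b x(1) aff_inj[OF w, of x b] by linarith
    moreover have "\<not> cg b (x + N)" using c by (simp add: cg_sym)
    ultimately show ?thesis
      using overlap[OF lm b(2)] aff_shift_one[OF w, of x] N_pos by simp
  qed
  define k s where "k = (w x - x) div N" and "s = (w x - x) mod N"
  have s: "0 \<le> s" "s < N" using N_pos by (simp_all add: s_def)
  have wx: "w x = x + s + k * N"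
    using div_mult_mod_eq[of "w x - x" N] by (simp add: k_def s_def)
  have disp: "disp w i = k + (if i < x + s then 1 else 0) + (\<Sum>b\<in>{x+1..<x+N}. cov w b i)"
    if i: "x \<le> i" "i < x + N" for i
  proof -
    have k: "0 \<le> k" using x(1) N_pos by (simp add: k_def pos_imp_zdiv_nonneg_iff)
    have arcx: "arc x (w x) i = k + (if i < x + s then 1 else 0)"
      unfolding wx arc_extend using arc_window[of x i x "x + s"] i s by simp
    have cov: "max 0 (arc b (w b) i) = cov w b i" if b: "b \<in> {x+1..<x+N}" for b
    proof (cases "w b \<le> b")
      case True
      then have "arc b (w b) i \<le> 0" using arc_nonneg arc_swap[of b] by (metis neg_le_0_iff_le)
      then show ?thesis using True by (simp add: cov_def)
    next
      case False
      then show ?thesis using arc_window[of x i b "w b"] i b low[of b] by (simp add: cov_def)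
    qed
    have "{x..<x+N} = insert x {x+1..<x+N}" using N_pos by auto
    then have "disp w i = max 0 (arc x (w x) i) + (\<Sum>b\<in>{x+1..<x+N}. max 0 (arc b (w b) i))"
      by (simp add: disp_window[OF w, of i x])
    then show ?thesis using k by (simp add: arcx cov)
  qed
  have "w (x - 1) < x"
    using low[of "x - 1 + N"] N_ge_3 aff_shift_one[OF w, of "x - 1"] by simp
  then have "disp w (x - 1) = m + arc p q (x - 1)"
    using x N_pos not_cg_succ[of "x - 1"] by (intro saturated[OF lm, of "x - 1" x]) auto
  moreover have "disp w (x - 1) = k"
  proof -
    have "(\<Sum>b\<in>{x+1..<x+N}. cov w b (x + N - 1)) = 0"
    proof (intro sum.neutral ballI)
      fix b assume "b \<in> {x+1..<x+N}"
      then show "cov w b (x + N - 1) = 0" using low[of b] by (auto simp: cov_def)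
    qed
    moreover have "disp w (x - 1) = disp w (x + N - 1)"
      using cg_shift_one(2)[of "x - 1" "x - 1"] by (intro disp_index) (simp add: algebra_simps)
    ultimately show ?thesis using disp[of "x + N - 1"] s N_pos by simp
  qed
  ultimately have k: "k = m + arc p q (x - 1)" by simp
  \<comment> \<open>Otherwise the long arc would pass every residue at least \<open>m + 1\<close>
    times, while only \<open>m\<close> is allowed at \<open>q\<close>.\<close>
  have "arc p q (x - 1) = 0"
  proof (rule ccontr)
    assume "arc p q (x - 1) \<noteq> 0"
    then have "m + 1 \<le> k" using k arc_nonneg[of p q "x - 1"] pq by simp
    moreover have "k \<le> disp w q"
      using disp_ge[OF w, of x q] arc_nonneg[of x "x + s" q] s unfolding wx arc_extend by simp
    ultimately show False using adm[of q] arc_pq[of q] pq by simp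
  qed
  moreover from this have "q - N < x"
    using arc_pq[of "x - 1 + 1 * N"] x pq unfolding arc_index by (auto split: if_splits)
  ultimately show thesis
    using that[of x s] x s wx low disp k by (simp add: algebra_simps)
qed

text \<open>Beyond the \<open>m\<close> full turns of the long arc, the coverage is exactly that of
  \<open>[p, q)\<close>. Either the remainder \<open>s\<close> of the long arc supplies it, or a
  separate arc from \<open>p\<close> to \<open>q\<close> does.\<close>

lemma up_structure:
  assumes lm: "locally_maximal w"
  shows "(w p = q + m * N \<and> (\<forall>b. \<not> cg b p \<longrightarrow> w b \<le> b)) \<or>
    (w p = q \<and> (\<exists>x. q - N < x \<and> x < p \<and> w x = x + m * N \<and>
      (\<forall>b. \<not> cg b p \<longrightarrow> \<not> cg b x \<longrightarrow> w b \<le> b)))"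
proof -
  have w: "w \<in> aff" and adm: "\<And>j. disp w j \<le> m + arc p q j"
    using lm by (simp_all add: locally_maximal_def admissible_def)
  obtain x s where x: "q - N < x" "x \<le> p" and s: "0 \<le> s" "s < N" and wx: "w x = x + m * N + s"
    and low: "\<And>b. x < b \<Longrightarrow> b < x + N \<Longrightarrow> w b < x + N"
    and disp: "\<And>i. x \<le> i \<Longrightarrow> i < x + N \<Longrightarrow>
      disp w i = m + (if i < x + s then 1 else 0) + (\<Sum>b\<in>{x+1..<x+N}. cov w b i)"
    using long_up[OF lm] by blast
  have xN: "cg x (x + m * N)" by simp
  have cov_nonneg: "0 \<le> cov w b i" for b i by (simp add: cov_def)
  have sum_nonneg: "0 \<le> (\<Sum>b\<in>{x+1..<x+N}. cov w b i)" for i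
    by (simp add: sum_nonneg cov_nonneg)
  \<comment> \<open>If the bound were not reached at \<open>i\<close>, no other arc would cover
    \<open>i\<close>, and an exchange with overlap just \<open>i\<close> could be found,
    contradicting \<open>saturated\<close>.\<close>
  have full: "disp w i = m + 1" if i: "p \<le> i" "i < q" for i
  proof (rule ccontr)
    assume ne: "disp w i \<noteq> m + 1"
    have arc: "arc p q i = 1" using arc_pq[of i] i pq by simp
    have ix: "x \<le> i" "i < x + N" "i + 1 < x + N" using i x by auto
    have "disp w i \<le> m + 1" using adm[of i] arc by simp
    then have si: "x + s \<le> i" and "(\<Sum>b\<in>{x+1..<x+N}. cov w b i) = 0"
      using disp[OF ix(1,2)] ne sum_nonneg[of i] by (auto split: if_splits)
    then have nc: "\<not> (b \<le> i \<and> i < w b)" if "x < b" "b < x + N" for b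
      using sum_nonneg_eq_0_iff[of "{x+1..<x+N}" "\<lambda>b. cov w b i"] that cov_nonneg
      by (auto simp: cov_def split: if_splits)
    define c where "c = pinv w (i + 1)"
    have wc: "w c = i + 1" using w by (simp add: c_def)
    \<comment> \<open>The position with value \<open>i + 1\<close> lies to the right of
      \<open>i\<close> and can serve as the right end of such an exchange.\<close>
    have c: "i + 1 \<le> c"
    proof (rule ccontr)
      assume "\<not> i + 1 \<le> c"
      obtain k where k: "x \<le> c + k * N" "c + k * N < x + N" by (rule window_rep)
      have wk: "w (c + k * N) = i + 1 + k * N" using wc aff_shift[OF w] by simp
      show False
      proof (cases "c + k * N = x")
        case True
        then have "x + s + m * N = i + 1 + k * N" using wk wx by simp
        then have "cg (x + s) (i + 1)" by (metis cg_shift cg_refl)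
        then show False using cg_close[of "x + s" "i + 1"] s ix si by simp
      next
        case False
        then have "x < c + k * N" using k by simp
        then have lt: "i + 1 + k * N < x + N" using low k wk by metis
        have "k = 0"
        proof (rule ccontr)
          assume "k \<noteq> 0"
          then consider "1 \<le> k" | "k \<le> -1" by linarith
          then show False
          proof cases
            case 1
            then have "1 * N \<le> k * N" by (intro mult_right_mono) auto
            then show False using lt ix by linarith
          next
            case 2
            then have "k * N \<le> -1 * N" by (intro mult_right_mono) auto
            then show False using k ix \<open>\<not> i + 1 \<le> c\<close> by linarith
          qed
        qed
        then show False using nc[of c] k wc \<open>\<not> i + 1 \<le> c\<close> \<open>x < c + k * N\<close> by simp
      qed
    qed
    have contra: False if "a < b" "\<not> cg a b" "w a < w b" "max a (w a) = i" "min b (w b) = i + 1" for a b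
      using saturated[OF lm that] ne arc by simp
    show False
    proof (cases "i = x")
      case True
      then have s0: "s = 0" using si s by simp
      \<comment> \<open>Position \<open>x\<close> itself moves up; the translate whose value is
        \<open>x\<close> serves as the left end.\<close>
      define a where "a = x + (- m) * N"
      have wa: "w a = x" using wx s0 aff_shift[OF w, of x "- m"] by (simp add: a_def)
      have "0 < m * N" using m_pos N_pos by simp
      then have "a < c" "a \<le> x" using c True by (simp_all add: a_def)
      moreover have "\<not> cg a c"
        using aff_cg[OF w, of a c] wa wc True by simp
      ultimately show False using contra[of a c] wa wc True c by simp
    next
      case False
      then have wi: "w i \<le> i" using nc[of i] ix by simp
      show False
      proof (cases "i < w (i + 1)")
        case True
        then show False using contra[of i "i + 1"] wi by simp
      next
        case F: False
        then have c1: "i + 1 < c" using c wc by (cases "c = i + 1") auto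
        show False
        proof (cases "cg i c")
          case True
          \<comment> \<open>The congruent positions \<open>i\<close> and \<open>c\<close> cannot be
            exchanged; here the pair \<open>i + 1\<close>, \<open>c\<close> already violates
            \<open>overlap\<close>.\<close>
          then have "\<not> cg (i + 1) c" using cg_trans cg_sym not_cg_succ by blast
          then show False using overlap[OF lm c1] F wc by simp
        next
          case False
          then show False using contra[of i c] c1 wi wc by simp
        qed
      qed
    qed
  qed
  have total: "(if i < x + s then 1 else 0) + (\<Sum>b\<in>{x+1..<x+N}. cov w b i) = (if p \<le> i \<and> i < q then 1 else 0)"
    if i: "x \<le> i" "i < x + N" for i
  proof (cases "p \<le> i \<and> i < q")
    case True
    then show ?thesis using disp[OF i] full[of i] by simp
  next
    case False
    have "arc p q i = 0"
    proof (cases "p \<le> i")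
      case True
      then show ?thesis using arc_pq[of i] False i x by simp
    next
      case F: False
      then show ?thesis using arc_pq[of "i + 1 * N"] i x pq unfolding arc_index by auto
    qed
    then show ?thesis using False disp[OF i] adm[of i] sum_nonneg[of i] by auto
  qed
  have cov1: "p \<le> i \<and> i < q \<and> x + s \<le> i" if "x < b" "b \<le> i" "i < w b" "b < x + N" for b i
  proof -
    have i: "x \<le> i" "i < x + N" using that low[of b] by auto
    have "cov w b i \<le> (\<Sum>b\<in>{x+1..<x+N}. cov w b i)"
      using that cov_nonneg by (intro member_le_sum) auto
    moreover have "cov w b i = 1" using that by (simp add: cov_def)
    ultimately show ?thesis using total[OF i] by (auto split: if_splits)
  qed
  have cov2: "b = b'" if "x < b" "b \<le> i" "i < w b" "b < x + N" "x < b'" "b' \<le> i" "i < w b'" "b' < x + N" for b b' i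
  proof (rule ccontr)
    assume ne: "b \<noteq> b'"
    have i: "x \<le> i" "i < x + N" using that low[of b] by auto
    have "(\<Sum>b\<in>{b, b'}. cov w b i) \<le> (\<Sum>b\<in>{x+1..<x+N}. cov w b i)"
      using that cov_nonneg by (intro sum_mono2) auto
    moreover have "(\<Sum>b\<in>{b, b'}. cov w b i) = 2" using that ne by (simp add: cov_def)
    ultimately show False using total[OF i] by (auto split: if_splits)
  qed
  have ex: "\<exists>b. x < b \<and> b \<le> i \<and> i < w b \<and> b < x + N" if "p \<le> i" "i < q" "x + s \<le> i" for i
  proof (rule ccontr)
    assume no: "\<nexists>b. x < b \<and> b \<le> i \<and> i < w b \<and> b < x + N"
    have "(\<Sum>b\<in>{x+1..<x+N}. cov w b i) = 0"
      using no by (intro sum.neutral ballI) (force simp: cov_def)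
    then show False using total[of i] that x by simp
  qed
  have reps: "\<exists>b'. x \<le> b' \<and> b' < x + N \<and> cg b b' \<and> (w b' \<le> b' \<longrightarrow> w b \<le> b)" for b
  proof -
    obtain k where k: "x \<le> b + k * N" "b + k * N < x + N" by (rule window_rep)
    then show ?thesis using aff_shift[OF w, of b k]
      by (intro exI[of _ "b + k * N"]) (simp add: cg_sym)
  qed
  show ?thesis
  proof (cases "s = 0")
    case False
    then have "x = p" using total[of x] x s N_pos sum_nonneg[of x] by (auto split: if_splits)
    have le: "x + s \<le> q"
      using total[of "x + s - 1"] False s sum_nonneg[of "x + s - 1"] by (auto split: if_splits)
    have "x + s = q"
    proof (rule ccontr)
      assume "x + s \<noteq> q"
      then have lt: "x + s < q" using le by simp
      then obtain b where b: "x < b" "b \<le> x + s" "x + s < w b" "b < x + N"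
        using ex[of "x + s"] s \<open>x = p\<close> by auto
      have "b = x + s" using cov1[of b b] b by simp
      then have "\<not> cg x (b + m * N)" using not_cg_close[of x b] b by simp
      \<comment> \<open>The long arc would end exactly where the translate of \<open>b\<close>
        starts, leaving no overlap between the two.\<close>
      then show False
        using overlap[OF lm, of x "b + m * N"] wx b \<open>b = x + s\<close> aff_shift[OF w, of b m] m_pos N_pos
        by (simp add: algebra_simps add_strict_increasing)
    qed
    moreover have "w b \<le> b" if "\<not> cg b p" for b
    proof -
      obtain b' where b': "x \<le> b'" "b' < x + N" "cg b b'" "w b' \<le> b' \<longrightarrow> w b \<le> b"
        using reps by blast
      have "x < b'" using b' that \<open>x = p\<close> by (cases "x = b'") auto
      then have "w b' \<le> b'" using cov1[of b' b'] b' \<open>x + s = q\<close> by (intro leI notI) auto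
      then show ?thesis using b' by simp
    qed
    ultimately show ?thesis using wx \<open>x = p\<close> by auto
  next
    case True
    obtain b where b: "x < b" "b \<le> p" "p < w b" "b < x + N"
      using ex[of p] True pq x by auto
    have "b = p" using cov1[of b b] b by simp
    have wp: "w p \<le> q" using cov1[of p "w p - 1"] b \<open>b = p\<close> by simp
    \<comment> \<open>If the arc of \<open>p\<close> ended before \<open>q\<close>, the next point
      would be covered by an arc starting exactly at that end, against
      \<open>overlap\<close>.\<close>
    have "w p = q"
    proof (rule ccontr)
      assume "w p \<noteq> q"
      then have "w p < q" using wp by simp
      then obtain b' where b': "x < b'" "b' \<le> w p" "w p < w b'" "b' < x + N"
        using ex[of "w p"] True b \<open>b = p\<close> x by auto
      have "p \<le> b'" using cov1[of b' b'] b' by simp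
      moreover have "b' \<noteq> p" using b' by auto
      ultimately have "p < b'" by simp
      moreover have "\<not> b' < w p"
        using cov2[of p b' b'] b b' \<open>b = p\<close> \<open>p < b'\<close> by (intro notI) auto
      moreover have "\<not> cg p b'" using not_cg_close[of p b'] \<open>p < b'\<close> b' x by simp
      ultimately show False using overlap[OF lm, of p b'] b' by simp
    qed
    moreover have "w b' \<le> b'" if "\<not> cg b' p" "\<not> cg b' x" for b'
    proof -
      obtain d where d: "x \<le> d" "d < x + N" "cg b' d" "w d \<le> d \<longrightarrow> w b' \<le> b'"
        using reps by blast
      have "x < d" "d \<noteq> p" using d that by (cases "x = d"; auto)+
      then have "w d \<le> d"
        using cov1[of d d] cov2[of d d p] d b \<open>b = p\<close> \<open>w p = q\<close> by (intro leI notI) auto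
      then show ?thesis using d by simp
    qed
    ultimately show ?thesis using wx True x b \<open>b = p\<close> by (intro disjI2 conjI exI[of _ x]) auto
  qed
qed

section \<open>The maximal elements\<close>


text \<open>\<open>x\<close> and \<open>y\<close> represent the classes shifted up and down after
  the reflection. The boundary value \<open>x = q\<close> means that the long upward arc starts at
  \<open>p\<close>, and \<open>y = p + N\<close> that the long downward arc starts at
  \<open>q\<close>; the ranges allow the class of \<open>q\<close> only to rise and that of
  \<open>p\<close> only to fall.\<close>

definition param :: "int \<Rightarrow> int \<Rightarrow> bool"
  where "param x y \<longleftrightarrow> q \<le> x \<and> x < p + N \<and> q < y \<and> y \<le> p + N \<and> x \<noteq> y"

definition top_elem :: "int \<Rightarrow> int \<Rightarrow> int \<Rightarrow> int"
  where "top_elem x y = shf m x y \<circ> trp p q"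

lemma not_cg_pq: "\<not> cg p q" "\<not> cg q p"
  using not_cg_close[OF pq] by (simp_all add: cg_sym[of q])

lemma top_elem_aff: "top_elem x y \<in> aff"
  by (simp add: top_elem_def aff_comp shf_aff trp_aff not_cg_pq)

lemma param_facts:
  assumes "param x y"
  shows "\<not> cg x y" "ind p x = 0" "ind q y = 0" "p < c \<Longrightarrow> c < q \<Longrightarrow> ind c x = 0 \<and> ind c y = 0"
proof -
  have xy: "q \<le> x" "x < p + N" "q < y" "y \<le> p + N" "x \<noteq> y" using assms by (simp_all add: param_def)
  show "\<not> cg x y" using cg_close[of x y] xy pq by auto
  show "ind p x = 0" "ind q y = 0"
    using not_cg_close[of p x] not_cg_close[of q y] xy pq by (simp_all add: ind_def)
  assume "p < c" "c < q"
  then show "ind c x = 0 \<and> ind c y = 0"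
    using not_cg_close[of c x] not_cg_close[of c y] xy by (simp add: ind_def)
qed

text \<open>\<open>up_structure\<close> for \<open>w\<close> finds the rising class and for the
  inverse the falling one. Every class apart from these two and those of \<open>p\<close> and
  \<open>q\<close> moves in neither direction.\<close>

lemma locally_maximal_top_elem:
  assumes lm: "locally_maximal w"
  shows "\<exists>x y. param x y \<and> w = top_elem x y"
proof -
  have w: "w \<in> aff" using lm by (simp add: locally_maximal_def admissible_def)
  have mN: "0 < m * N" using m_pos N_pos by simp
  obtain X where X: "q \<le> X" "X < p + N" "w p = q + m * N * ind q X" "X \<noteq> q \<Longrightarrow> w X = X + m * N"
    and upX: "\<And>b. \<not> cg b p \<Longrightarrow> \<not> cg b X \<Longrightarrow> w b \<le> b"
  proof (rule disjE[OF up_structure[OF lm]])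
    assume "w p = q + m * N \<and> (\<forall>b. \<not> cg b p \<longrightarrow> w b \<le> b)"
    then show thesis using that[of q] pq by (simp add: ind_def)
  next
    assume R: "w p = q \<and> (\<exists>x. q - N < x \<and> x < p \<and> w x = x + m * N \<and>
      (\<forall>b. \<not> cg b p \<longrightarrow> \<not> cg b x \<longrightarrow> w b \<le> b))"
    then obtain x where x: "q - N < x" "x < p" "w x = x + m * N"
      "\<And>b. \<not> cg b p \<Longrightarrow> \<not> cg b x \<Longrightarrow> w b \<le> b" by blast
    have "\<not> cg q (x + N)" using x pq by (intro not_cg_close) auto
    then show thesis using that[of "x + N"] x R aff_shift_one[OF w, of x] by (simp add: ind_def)
  qed
  obtain Y where Y: "q < Y" "Y \<le> p + N" "w q = p - m * N * ind p Y" "Y \<noteq> p + N \<Longrightarrow> w Y = Y - m * N"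
    and upY: "\<And>b. \<not> cg b p \<Longrightarrow> \<not> cg b Y \<Longrightarrow> pinv w b \<le> b"
  proof (rule disjE[OF up_structure[OF locally_maximal_inv[OF lm]]])
    assume L: "pinv w p = q + m * N \<and> (\<forall>b. \<not> cg b p \<longrightarrow> pinv w b \<le> b)"
    then have "w (q + m * N) = p" using w by (metis inv_apply(2))
    then have "w q = p - m * N" using aff_shift[OF w, of q m] by simp
    then show thesis using that[of "p + N"] pq L by (simp add: ind_def)
  next
    assume R: "pinv w p = q \<and> (\<exists>x. q - N < x \<and> x < p \<and> pinv w x = x + m * N \<and>
      (\<forall>b. \<not> cg b p \<longrightarrow> \<not> cg b x \<longrightarrow> pinv w b \<le> b))"
    then obtain x where x: "q - N < x" "x < p" "pinv w x = x + m * N"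
      "\<And>b. \<not> cg b p \<Longrightarrow> \<not> cg b x \<Longrightarrow> pinv w b \<le> b" by blast
    have "w q = p" using R w by (metis inv_apply(2))
    moreover have "w (x + m * N) = x" using x w by (metis inv_apply(2))
    then have "w (x + N) = x + N - m * N"
      using aff_shift[OF w, of x m] aff_shift_one[OF w, of x] by simp
    moreover have "\<not> cg p (x + N)" using x pq by (intro not_cg_close) auto
    ultimately show thesis using that[of "x + N"] x by (simp add: ind_def)
  qed
  \<comment> \<open>A common value would differ from both boundary values, so the same class would
    have to rise and fall.\<close>
  have "X \<noteq> Y" using X Y mN by auto
  then have pXY: "param X Y" using X Y by (simp add: param_def)
  note pf = param_facts[OF pXY]
  have "w c = top_elem X Y c" for c
  proof -
    consider k where "c = p + k * N" | k where "c = q + k * N" | "\<not> cg c p" "\<not> cg c q"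
      by (auto simp: cg_iff)
    then show ?thesis
    proof cases
      case 1
      then have "trp p q c = q + k * N" by (simp add: trp_def)
      then show ?thesis using 1 X(3) pf by (simp add: top_elem_def shf_def aff_shift[OF w])
    next
      case 2
      then have "trp p q c = p + k * N" using not_cg_pq by (simp add: trp_def)
      then show ?thesis using 2 Y(3) pf by (simp add: top_elem_def shf_def aff_shift[OF w])
    next
      case 3
      then have c: "top_elem X Y c = c + m * N * (ind c X - ind c Y)"
        by (simp add: top_elem_def trp_def shf_def)
      show ?thesis
      proof (cases "cg c X \<or> cg c Y")
        case True
        have excl: "\<not> (cg c X \<and> cg c Y)" using pf(1) cg_trans cg_sym by blast
        show ?thesis
        proof (cases "cg c X")
          case True
          then obtain k where k: "c = X + k * N" by (auto simp: cg_iff)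
          have "X \<noteq> q" using True 3 by auto
          then have "w c = c + m * N" using X(4) k aff_shift[OF w] by simp
          then show ?thesis using True excl c by (simp add: ind_def)
        next
          case False
          then obtain k where k: "c = Y + k * N" using \<open>cg c X \<or> cg c Y\<close> by (auto simp: cg_iff)
          have "Y \<noteq> p + N" using k 3 by auto
          then have "w c = c - m * N" using Y(4) k aff_shift[OF w] by simp
          then show ?thesis using False k c by (simp add: ind_def)
        qed
      next
        case False
        then have "w c \<le> c" using upX 3 by blast
        moreover have "\<not> cg (w c) p"
        proof
          assume "cg (w c) p"
          moreover have "w q = p + (- m * ind p Y) * N" using Y(3) by (simp add: algebra_simps)
          ultimately have "cg (w c) (w q)" by (simp only: cg_shift)
          then show False using 3 aff_cg[OF w] by blast
        qed
        moreover have "\<not> cg (w c) Y"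
        proof
          assume a: "cg (w c) Y"
          show False
          proof (cases "Y = p + N")
            case True
            then show False using a \<open>\<not> cg (w c) p\<close> by simp
          next
            case F: False
            then have "cg (w c) (w Y)"
              using a Y(4) cg_shift(2)[of "w c" Y "- m"] by simp
            then show False using aff_cg[OF w] False by blast
          qed
        qed
        \<comment> \<open>The value is outside the classes on which the inverse may rise, so
          \<open>c \<le> w c\<close> as well.\<close>
        ultimately have "w c = c" using upY[of "w c"] w by simp
        then show ?thesis using False c by (simp add: ind_def)
      qed
    qed
  qed
  then show ?thesis using pXY by blast
qed

text \<open>The translation uses \<open>m\<close> everywhere, and composing with the reflection adds
  at most its arc.\<close>

lemma admissible_top_elem: "param x y \<Longrightarrow> admissible (top_elem x y)"
  using disp_comp_trp_le[OF shf_aff pq(1) not_cg_pq(1), of m x y] disp_shf[of m x y] m_pos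
  by (simp add: admissible_def top_elem_aff top_elem_def[symmetric] param_facts(1))

text \<open>In the window at \<open>p\<close> each floor term splits without cancellation into that
  of the reflection and \<open>m\<close> times the shifts of both positions. Each position lies in
  \<open>n - 1\<close> pairs and two classes are shifted, which yields
  \<open>2 * m * (N - 1)\<close>.\<close>

lemma invs_top_elem:
  assumes xy: "param x y"
  shows "invs p (top_elem x y) = invs p (trp p q) + 2 * m * (N - 1)"
proof -
  define e where "e c = ind c x - ind c y" for c
  define s where "s = trp p q"
  note pf = param_facts[OF xy]
  have s_aff: "s \<in> aff" by (simp add: s_def trp_aff not_cg_pq)
  have s: "s p = q" "s q = p" by (simp_all add: s_def trp_right not_cg_pq)
  have s_fix: "s c = c" if "p \<le> c" "c < p + N" "c \<noteq> p" "c \<noteq> q" for c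
    using that cg_close[of c p] cg_close[of c q] pq by (auto simp: s_def trp_def)
  have ep: "e p \<le> 0" and eq: "0 \<le> e q" and ein: "p < c \<Longrightarrow> c < q \<Longrightarrow> e c = 0" for c
    using pf ind_bounds by (simp_all add: e_def)
  have term_eq: "\<bar>(top_elem x y b - top_elem x y a) div N\<bar>
      = \<bar>(s b - s a) div N\<bar> + m * (\<bar>e (s a)\<bar> + \<bar>e (s b)\<bar>)" if ab: "(a, b) \<in> window_pairs p" for a b
  proof -
    have ab: "p \<le> a" "a < b" "b < p + N" using that by (simp_all add: window_pairs_def)
    have rng: "p \<le> s c \<and> s c < p + N" if "p \<le> c" "c < p + N" for c
      using that s s_fix[of c] pq by (cases "c = p"; cases "c = q") auto
    have ra: "p \<le> s a" "s a < p + N" and rb: "p \<le> s b" "s b < p + N"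
      using rng[of a] rng[of b] ab by auto
    have ne: "\<not> cg (s a) (s b)" using not_cg_close[of a b] ab aff_cg[OF s_aff] by simp
    have "top_elem x y b - top_elem x y a = (s b - s a) + (m * (e (s b) - e (s a))) * N"
      by (simp add: top_elem_def shf_def e_def s_def algebra_simps)
    then have div: "(top_elem x y b - top_elem x y a) div N = (s b - s a) div N + m * (e (s b) - e (s a))"
      by (simp only: div_shift)
    have A: "(s b - s a) div N = (if s a \<le> s b then 0 else -1)"
      using small_div[of "s b - s a"] ra rb by simp
    \<comment> \<open>This is where the ranges in \<open>param\<close> matter: on a pair reversed by
      the reflection the translation never pulls the floor term back, since \<open>e\<close> is at
      most \<open>0\<close> at \<open>p\<close>, at least \<open>0\<close> at \<open>q\<close>, and
      zero between.\<close>
    have E: "e (s b) \<le> e (s a)" if lt: "s b < s a"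
    proof (cases "a = p")
      case True
      show ?thesis
      proof (cases "b = q")
        case True
        then show ?thesis using \<open>a = p\<close> s ep eq by simp
      next
        case False
        then have "s b = b" using s_fix[of b] ab by simp
        then show ?thesis using lt True s eq ein[of b] ab by simp
      qed
    next
      case False
      have "a \<noteq> q" using lt s rb by auto
      then have sa: "s a = a" using s_fix[of a] ab False by simp
      have "b = q" using s_fix[of b] ab lt sa by fastforce
      then show ?thesis using s sa ep ein[of a] ab False by simp
    qed
    \<comment> \<open>Distinct classes cannot both rise or both fall, so the two shifts never have
      the same nonzero sign.\<close>
    have abs: "\<bar>e (s b) - e (s a)\<bar> = \<bar>e (s a)\<bar> + \<bar>e (s b)\<bar>"
    proof -
      have "\<not> (cg (s a) x \<and> cg (s b) x)" "\<not> (cg (s a) y \<and> cg (s b) y)"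
        "\<not> (cg (s a) x \<and> cg (s a) y)" "\<not> (cg (s b) x \<and> cg (s b) y)"
        using ne pf(1) cg_common cg_common' by blast+
      then show ?thesis by (auto simp: e_def ind_def)
    qed
    have "\<bar>(top_elem x y b - top_elem x y a) div N\<bar> = \<bar>(s b - s a) div N\<bar> + m * \<bar>e (s b) - e (s a)\<bar>"
    proof (cases "s a \<le> s b")
      case True
      then show ?thesis using A m_pos unfolding div by (simp add: abs_mult)
    next
      case False
      then have "m * (e (s b) - e (s a)) \<le> 0" using E m_pos by (simp add: mult_nonneg_nonpos)
      moreover have "m * \<bar>e (s b) - e (s a)\<bar> = \<bar>m * (e (s b) - e (s a))\<bar>"
        using m_pos by (simp add: abs_mult)
      ultimately show ?thesis using A False unfolding div by simp
    qed
    then show ?thesis unfolding abs .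
  qed
  have "invs p (top_elem x y) = (\<Sum>(a, b)\<in>window_pairs p. \<bar>(s b - s a) div N\<bar>
      + m * (\<bar>e (s a)\<bar> + \<bar>e (s b)\<bar>))"
    unfolding invs_def by (intro sum.cong refl) (auto simp: term_eq)
  also have "\<dots> = invs p s + m * (\<Sum>(a, b)\<in>window_pairs p. \<bar>e (s a)\<bar> + \<bar>e (s b)\<bar>)"
    unfolding invs_def sum_distrib_left sum.distrib[symmetric] by (intro sum.cong) auto
  also have "(\<Sum>(a, b)\<in>window_pairs p. \<bar>e (s a)\<bar> + \<bar>e (s b)\<bar>) = (N - 1) * (\<Sum>a\<in>{p..<p+N}. \<bar>e (s a)\<bar>)"
    by (rule sum_window_pairs)
  also have "(\<Sum>a\<in>{p..<p+N}. \<bar>e (s a)\<bar>) = (\<Sum>a\<in>{p..<p+N}. \<bar>e a\<bar>)"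
    by (rule sum_reindex_window[of s "\<lambda>a. \<bar>e a\<bar>"])
      (simp_all add: aff_bij aff_shift_one s_aff e_def)
  also have "\<dots> = (\<Sum>a\<in>{p..<p+N}. ind a x * 1) + (\<Sum>a\<in>{p..<p+N}. ind a y * 1)"
  proof -
    have "\<bar>e a\<bar> = ind a x * 1 + ind a y * 1" for a
      using pf(1) cg_common'[of a x y] by (auto simp: e_def ind_def)
    then show ?thesis by (simp add: sum.distrib)
  qed
  also have "\<dots> = 2" by (simp only: sum_ind)
  finally show ?thesis by (simp add: s_def)
qed

lemma len_top_elem:
  assumes "param x y"
  shows "int (len n (act (top_elem x y))) = int (len n (act (trp p q))) + 2 * m * (N - 1)"
  using len_act[OF top_elem_aff, of x y p] len_act[OF trp_aff[OF not_cg_pq(1)], of p]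
    invs_top_elem[OF assms] invs_nonneg[of p "top_elem x y"] invs_nonneg[of p "trp p q"] by simp

text \<open>Every displacement is at most \<open>m + 1\<close>, which bounds the movement of each
  position in both directions and hence every floor term. The bound makes climbing by exchanges
  terminate.\<close>

lemma len_bounded:
  "\<exists>L. \<forall>w. admissible w \<longrightarrow> len n (act w) \<le> L"
proof (intro exI allI impI)
  fix w assume adm: "admissible w"
  then have w: "w \<in> aff" by (simp add: admissible_def)
  have arc1: "arc p q j \<le> 1" for j
    using arc_add[of p q j "p + N"] arc_full_one[of p j] arc_nonneg[of q "p + N" j] pq by simp
  have le: "u a - a \<le> (m + 1) * N" if "admissible u" for u a
  proof -
    have u: "u \<in> aff" "disp u j \<le> m + arc p q j" for j using that by (simp_all add: admissible_def)
    have "arc a (u a) j \<le> m + 1" for j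
      using disp_ge[OF u(1), of a j] u(2)[of j] arc1[of j] by linarith
    then have "(\<Sum>j\<in>{0..<N}. arc a (u a) j) \<le> (\<Sum>j\<in>{0..<N}. m + 1)" by (rule sum_mono)
    then show ?thesis by (simp add: sum_arc mult.commute)
  qed
  have dist: "\<bar>w a - a\<bar> \<le> (m + 1) * N" for a
    using le[OF adm, of a] le[OF admissible_inv[OF adm], of "w a"] w by simp
  \<comment> \<open>Each endpoint contributes \<open>m + 1\<close> periods, and their own distance
    contributes less than one more.\<close>
  have "invs 0 w \<le> (\<Sum>z\<in>window_pairs 0. 2 * m + 3)"
    unfolding invs_def
  proof (rule sum_mono, clarify)
    fix a b assume "(a, b) \<in> window_pairs 0"
    then have "\<bar>w b - w a\<bar> \<le> (2 * m + 3) * N"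
      using dist[of a] dist[of b] by (auto simp: window_pairs_def algebra_simps)
    then show "\<bar>(w b - w a) div N\<bar> \<le> 2 * m + 3" by (rule abs_div_le)
  qed
  then show "len n (act w) \<le> nat (\<Sum>z\<in>window_pairs 0. 2 * m + 3)"
    using len_act[OF w, of 0] by simp
qed

text \<open>Admissible length-increasing exchanges are Bruhat steps; repeating them ends at a
  locally maximal element.\<close>

lemma below_top_elem:
  assumes "admissible w"
  shows "\<exists>x y. param x y \<and> bruhat_le n (act w) (act (top_elem x y))"
proof -
  obtain L where L: "\<And>w. admissible w \<Longrightarrow> len n (act w) \<le> L" using len_bounded by blast
  show ?thesis using assms
  proof (induction "L - len n (act w)" arbitrary: w rule: less_induct)
    case less
    have w: "w \<in> aff" using less.prems by (simp add: admissible_def)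
    show ?case
    proof (cases "locally_maximal w")
      case True
      then obtain x y where "param x y" "w = top_elem x y" using locally_maximal_top_elem by blast
      then show ?thesis using w by (auto simp: bruhat_le_def Waff_eq)
    next
      case False
      then obtain a b where ab: "a < b" "\<not> cg a b" "w a < w b" "admissible (w \<circ> trp a b)"
        using less.prems by (auto simp: locally_maximal_def)
      let ?u = "w \<circ> trp a b"
      have lt: "len n (act w) < len n (act ?u)" by (rule len_less[OF w ab(1-3)])
      moreover have "len n (act ?u) \<le> L" using L ab by blast
      ultimately obtain x y where xy: "param x y" "bruhat_le n (act ?u) (act (top_elem x y))"
        using less.hyps[of ?u] ab by fastforce
      have "root a b \<in> pos_real_roots n" using ab by (auto simp: pos_real_roots_eq)
      moreover have "act ?u = act w \<circ> reflect n (root a b)"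
        using act_comp[OF w, of "trp a b"] ab by (simp add: act_trp)
      ultimately have "bruhat_step n (act w) (act ?u)"
        using w lt by (auto simp: bruhat_step_def Waff_eq)
      then have "bruhat_le n (act w) (act (top_elem x y))"
        using xy w by (auto simp: bruhat_le_def Waff_eq)
      then show ?thesis using xy by blast
    qed
  qed
qed

section \<open>The curve neighborhood of the identity\<close>

lemma reachable_admissible:
  "reachable n (m *\<^sub>Z cc n + root p q) id = {act w | w. admissible w}"
proof -
  have "dispv w \<le> m *\<^sub>Z cc n + root p q \<longleftrightarrow> (\<forall>j. disp w j \<le> m + arc p q j)" for w
  proof -
    have cc: "cc n j = (if j < n then 1 else 0)" for j
      by (simp add: cc_eq[of 0] root_def arc_full_one[of 0, simplified])
    have "dispv w \<le> m *\<^sub>Z cc n + root p q \<longleftrightarrow> (\<forall>j<n. disp w (int j) \<le> m + arc p q (int j))"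
      by (auto simp: le_fun_def dispv_def scale_def cc root_def)
    also have "\<dots> \<longleftrightarrow> (\<forall>j. disp w j \<le> m + arc p q j)"
    proof (intro iffI allI impI)
      fix j assume "\<forall>j<n. disp w (int j) \<le> m + arc p q (int j)"
      moreover have "int (nat (j mod N)) = j mod N" "nat (j mod N) < n"
        using N_pos by (simp_all add: nat_less_iff)
      ultimately have "disp w (j mod N) \<le> m + arc p q (j mod N)" by metis
      moreover have "cg (j mod N) j" by simp
      ultimately show "disp w j \<le> m + arc p q j" using disp_index arc_cg by metis
    qed blast
    finally show ?thesis .
  qed
  then show ?thesis unfolding reachable_id admissible_def by auto
qed

lemma curve_nbhd_eq:
  "curve_nbhd n (m *\<^sub>Z cc n + root p q) id = {act (top_elem x y) | x y. param x y}"
proof (intro subset_antisym subsetI)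
  fix v assume v: "v \<in> curve_nbhd n (m *\<^sub>Z cc n + root p q) id"
  then obtain w where "v = act w" "admissible w" by (auto simp: curve_nbhd_def reachable_admissible)
  then obtain x y where xy: "param x y" "bruhat_le n v (act (top_elem x y))"
    using below_top_elem by blast
  have "act (top_elem x y) \<in> reachable n (m *\<^sub>Z cc n + root p q) id"
    using admissible_top_elem[OF xy(1)] unfolding reachable_admissible by blast
  then have "act (top_elem x y) = v" using v xy(2) unfolding curve_nbhd_def by blast
  then show "v \<in> {act (top_elem x y) | x y. param x y}" using xy(1) by blast
next
  fix v assume "v \<in> {act (top_elem x y) | x y. param x y}"
  then obtain x y where xy: "param x y" "v = act (top_elem x y)" by blast
  have "u = v" if u: "u \<in> {act w | w. admissible w}" "bruhat_le n v u" for u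
  proof -
    obtain x' y' where xy': "param x' y'" "bruhat_le n u (act (top_elem x' y'))"
      using u below_top_elem by blast
    \<comment> \<open>All these elements have equal length, so \<open>u\<close>, squeezed between
      two of them, leaves no room for a strict step.\<close>
    then have "len n (act (top_elem x' y')) = len n v"
      using len_top_elem[OF xy(1)] len_top_elem[OF xy'(1)] xy(2) by simp
    then show ?thesis using bruhat_le_len[OF u(2)] bruhat_le_len[OF xy'(2)] by auto
  qed
  then show "v \<in> curve_nbhd n (m *\<^sub>Z cc n + root p q) id"
    using xy admissible_top_elem by (auto simp: curve_nbhd_def reachable_admissible)
qed

section \<open>The roots that index the maximal elements\<close>

definition param_root :: "int \<Rightarrow> int \<Rightarrow> rvec"
  where "param_root x y = (if x < y then root x y else root x (y + N))"

lemma eps_root: "eps (root a b) c = arc a b c - arc a b (c - 1)"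
  by (simp add: eps_per per_root)

text \<open>For \<open>x < y\<close> the interval lies in the complement \<open>[q, p + n)\<close>
  of \<open>[p, q)\<close>, which is the first alternative. For \<open>y < x\<close> the root wraps
  around and contains \<open>[p, q)\<close> together with \<open>p - 1\<close> and \<open>q\<close>,
  which is what orthogonality adds to the inclusion.\<close>

lemma pos_real_roots_at_eq:
  "pos_real_roots_at n (root p q) = {param_root x y | x y. param x y}"
proof (intro subset_antisym subsetI)
  fix \<beta> assume \<beta>: "\<beta> \<in> pos_real_roots_at n (root p q)"
  then have "\<beta> \<in> pos_real_roots n" "\<beta> < cc n" by (auto simp: pos_real_roots_at_def)
  then obtain x0 y0 where xy0: "\<beta> = root x0 y0" "x0 < y0" "\<not> cg x0 y0"
    by (auto simp: pos_real_roots_eq)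
  have arc_le: "arc x0 y0 j \<le> 1" for j
  proof -
    have "root x0 y0 \<le> root 0 (0 + N)" using \<open>\<beta> < cc n\<close> xy0(1) cc_eq[of 0] by (simp add: less_le)
    then show ?thesis unfolding root_le_iff arc_full_one by blast
  qed
  have y0: "y0 < x0 + N"
  proof (rule ccontr)
    assume "\<not> y0 < x0 + N"
    then have "x0 + N < y0" using xy0(3) by (cases "y0 = x0 + N") auto
    then have "1 \<le> arc (x0 + N) y0 (x0 + 1 * N)" by (intro arc_ge_1) auto
    then show False
      using arc_add[of x0 "x0 + N" x0 y0] arc_full_one[of x0 x0] arc_le[of x0]
      unfolding arc_index by simp
  qed
  have shift: "\<beta> = root (x0 + k * N) (y0 + k * N)" for k
    using xy0(1) root_shift by simp
  consider "\<beta> \<le> cc n - root p q" | "root p q < \<beta>" "form n \<beta> (root p q) = 0"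
    using \<beta> by (auto simp: pos_real_roots_at_def)
  then show "\<beta> \<in> {param_root x y | x y. param x y}"
  proof cases
    case 1
    obtain k where k: "p \<le> x0 + k * N" "x0 + k * N < p + N" by (rule window_rep)
    define x y where "x = x0 + k * N" and "y = y0 + k * N"
    have b: "\<beta> = root x y" "x < y" "y < x + N" using shift xy0 y0 by (simp_all add: x_def y_def)
    have disj: "arc x y j + arc p q j \<le> 1" for j
    proof -
      have "root x y \<le> root p (p + N) - root p q" using 1 b(1) cc_eq[of p] by simp
      also have "\<dots> = root q (p + N)" using root_add[of p q "p + N"] by (simp add: algebra_simps)
      finally have "arc x y j \<le> arc q (p + N) j" unfolding root_le_iff by blast
      then show ?thesis
        using arc_add[of p q j "p + N"] arc_full_one[of p j] by simp
    qed
    have "p \<le> x" using k by (simp add: x_def)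
    have "q \<le> x"
    proof (rule ccontr)
      assume "\<not> q \<le> x"
      then show False
        using disj[of x] arc_ge_1[of x x y] arc_ge_1[of p x q] b(2) \<open>p \<le> x\<close> by linarith
    qed
    moreover have "y \<le> p + N"
    proof (rule ccontr)
      assume "\<not> y \<le> p + N"
      then have "1 \<le> arc x y (p + 1 * N)" using k by (intro arc_ge_1) (auto simp: x_def)
      then show False using disj[of p] arc_ge_1[of p p q] pq unfolding arc_index by simp
    qed
    ultimately have "param x y" "param_root x y = \<beta>" using b k
      by (auto simp: param_def param_root_def x_def)
    then show ?thesis by blast
  next
    case 2
    have sub: "arc p q j \<le> arc x0 y0 j" for j
      using 2(1) xy0(1) by (simp add: less_le root_le_iff)
    have "0 < arc x0 y0 p" using sub[of p] arc_ge_1[of p p q] pq by simp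
    then obtain k where k: "x0 \<le> p + k * N" "p + k * N < y0" by (rule arc_pos)
    define x y where "x = x0 + (- k) * N" and "y = y0 + (- k) * N"
    have b: "\<beta> = root x y" "x < y" "y < x + N" "x \<le> p" "p < y"
      using shift[of "- k"] xy0 y0 k by (simp_all add: x_def y_def)
    have sub: "arc p q j \<le> arc x y j" for j
      using sub[of j] arc_shift[of x0 "- k" y0 j] by (simp add: x_def y_def)
    have win: "arc x y j = (if j < y then 1 else 0)" if "x \<le> j" "j < x + N" for j
      using arc_window[of x j x y] that b by simp
    have "q \<le> y"
    proof (rule ccontr)
      assume "\<not> q \<le> y"
      then show False using sub[of y] win[of y] b arc_ge_1[of p y q] by simp
    qed
    have "form n \<beta> (root p q) = arc x y p - arc x y (p - 1) - arc x y q + arc x y (q - 1)"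
      using b(1) form_root[of \<beta> p q] by (simp add: eps_root)
    moreover have "arc x y p = 1" "arc x y (q - 1) = 1"
      using win[of p] win[of "q - 1"] b pq \<open>q \<le> y\<close> by simp_all
    moreover have "arc x y j \<le> 1" for j
      using arc_le[of j] arc_shift[of x0 "- k" y0 j] by (simp add: x_def y_def)
    \<comment> \<open>Orthogonality makes these two coefficients sum to \<open>2\<close>, and
      neither exceeds \<open>1\<close>.\<close>
    ultimately have ends: "arc x y (p - 1) = 1" "arc x y q = 1"
      using 2(2) by (smt (verit))+
    have "x \<noteq> p"
      using ends(1) win[of "x + N - 1"] arc_index[of x y "x - 1" 1] b N_ge_3
      by (auto simp: algebra_simps)
    moreover have "y \<noteq> q" using ends(2) win[of q] b by auto
    ultimately have "param (x + N) y" "param_root (x + N) y = \<beta>"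
      using b \<open>q \<le> y\<close> pq root_shift[of x 1 y] by (auto simp: param_def param_root_def)
    then show ?thesis by blast
  qed
next
  fix \<beta> assume "\<beta> \<in> {param_root x y | x y. param x y}"
  then obtain x y where xy: "q \<le> x" "x < p + N" "q < y" "y \<le> p + N" "x \<noteq> y"
    and \<beta>: "\<beta> = param_root x y" by (auto simp: param_def)
  define z where "z = (if x < y then y else y + N)"
  have z: "\<beta> = root x z" "x < z" "z < x + N" using xy pq \<beta> by (auto simp: z_def param_root_def)
  have "\<beta> \<in> pos_real_roots n"
    unfolding pos_real_roots_eq using z not_cg_close[of x z] by blast
  moreover have "\<beta> < cc n"
  proof -
    have "root x z \<le> root x (x + N)" unfolding root_le_iff
      using arc_add[of x z _ "x + N"] arc_nonneg[of z "x + N"] z by (smt (verit))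
    moreover have "root x z \<noteq> root x (x + N)"
      using arc_window[of x z x z] z N_pos arc_full_one[of x z] unfolding root_eq_iff
      by (intro notI) (auto dest: spec[of _ z])
    ultimately show ?thesis unfolding z(1) cc_eq[of x] by (simp add: less_le)
  qed
  moreover have "\<beta> \<le> cc n - root p q \<or> root p q < \<beta> \<and> form n \<beta> (root p q) = 0"
  proof (cases "x < y")
    case True
    have "root x z \<le> root q (p + N)" unfolding root_le_iff
    proof
      fix j
      have "arc q (p + N) j = arc q x j + arc x z j + arc z (p + N) j" by (simp add: arc_add)
      then show "arc x z j \<le> arc q (p + N) j"
        using arc_nonneg[of q x j] arc_nonneg[of z "p + N" j] xy True by (simp add: z_def)
    qed
    also have "root q (p + N) = cc n - root p q"
      using root_add[of p q "p + N"] cc_eq[of p] by (simp add: algebra_simps)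
    finally show ?thesis using z by simp
  next
    case False
    then have x: "q < x" "y < x" "y < p + N" and z': "z = y + N" using xy by (auto simp: z_def)
    have split: "arc x z j = arc x (p + N) j + arc p q j + arc q y j" for j
      using arc_add[of x "p + N" j "q + N"] arc_add[of x "q + N" j z] by (simp add: z')
    have win: "arc x z j = arc x z (j + N)" for j using arc_index[of x z j 1] by simp
    have "root p q \<le> root x z" unfolding root_le_iff
      using split arc_nonneg[of x "p + N"] arc_nonneg[of q y] xy by (smt (verit))
    moreover have "arc p q q \<noteq> arc x z q"
      using split[of q] arc_ge_1[of q q y] arc_nonneg[of x "p + N" q] xy by simp
    then have "root p q \<noteq> root x z" by (auto simp: root_eq_iff)
    moreover have "form n \<beta> (root p q) = 0"
    proof -
      have inside: "arc x z j = 1" if "x \<le> j" "j < z" for j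
        using arc_window[of x j x z] that z by simp
      have "arc x z p = 1" "arc x z (p - 1) = 1" "arc x z q = 1" "arc x z (q - 1) = 1"
        using inside[of "p + N"] inside[of "p - 1 + N"] inside[of "q + N"] inside[of "q - 1 + N"]
          win[of p] win[of "p - 1"] win[of q] win[of "q - 1"] x z' xy pq by auto
      then show ?thesis using z(1) form_root[of \<beta> p q] by (simp add: eps_root)
    qed
    ultimately show ?thesis using z by (simp add: less_le)
  qed
  ultimately show "\<beta> \<in> pos_real_roots_at n (root p q)" by (simp add: pos_real_roots_at_def)
qed

text \<open>\<open>shf\<close> sees only the class of \<open>y\<close>, so a wrapped root gives the
  same shift, and subtracting \<open>cc n\<close> does not affect the translation.\<close>

lemma act_top_elem:
  assumes "\<mu> = m *\<^sub>Z param_root x y \<or> \<mu> = m *\<^sub>Z (param_root x y - cc n)"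
  shows "act (top_elem x y) = transl n \<mu> \<circ> reflect n (root p q)"
proof -
  define z where "z = (if x < y then y else y + N)"
  have "shf m x z = shf m x y" by (auto simp: z_def shf_def)
  moreover have "act (shf m x z) = transl n \<mu>"
    using assms by (intro act_shf) (auto simp: param_root_def z_def)
  ultimately show ?thesis
    using act_comp[OF shf_aff, of m x y "trp p q"] act_trp[OF not_cg_pq(1)]
    by (simp add: top_elem_def)
qed

text \<open>After cancelling the reflection, \<open>x\<close> and \<open>y\<close> are recovered as
  the only class that rises and the only one that falls.\<close>

lemma act_top_elem_inject:
  assumes xy: "param x y" "param x' y'" and eq: "act (top_elem x y) = act (top_elem x' y')"
  shows "x = x' \<and> y = y'"
proof -
  have "top_elem x y = top_elem x' y'" by (rule act_inject[OF top_elem_aff top_elem_aff eq])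
  then have "top_elem x y (trp p q c) = top_elem x' y' (trp p q c)" for c by simp
  then have shf: "shf m x y c = shf m x' y' c" for c
    by (simp add: top_elem_def trp_trp not_cg_pq)
  have "m * N \<noteq> 0" using m_pos N_pos by simp
  then have ind: "ind c x - ind c y = ind c x' - ind c y'" for c
    using shf[of c] by (simp add: shf_def)
  have "cg x x'" "cg y y'"
    using ind[of x] ind[of y] param_facts(1)[OF xy(1)] cg_sym[of x y]
    by (auto simp: ind_def split: if_splits)
  then show ?thesis
    using xy cg_close[of x x'] cg_close[of y y'] pq by (simp add: param_def)
qed

end

section \<open>Transfer to an arbitrary positive real root below \<open>c\<close>\<close>

theorem theorem1p12:
  fixes n m :: nat and \<alpha> :: rvec
  assumes "n \<ge> 3"
    and "\<alpha> \<in> pos_real_roots n"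
    and "\<alpha> < cc n"
    and "m > 0"
  shows "curve_nbhd n (int m *\<^sub>Z cc n + \<alpha>) id =
      {transl n (int m *\<^sub>Z \<beta>) \<circ> reflect n \<alpha> | \<beta>.
        \<beta> \<in> pos_real_roots_at n \<alpha> \<and> simple_root 0 \<notin> supp n \<beta>}
      \<union> {transl n (int m *\<^sub>Z (\<beta> - cc n)) \<circ> reflect n \<alpha> | \<beta>.
        \<beta> \<in> pos_real_roots_at n \<alpha> \<and> simple_root 0 \<in> supp n \<beta>}
    \<and> card (curve_nbhd n (int m *\<^sub>Z cc n + \<alpha>) id) = card (pos_real_roots_at n \<alpha>)
    \<and> (\<forall>w \<in> curve_nbhd n (int m *\<^sub>Z cc n + \<alpha>) id.
      len n w = 2 * m * (n - 1) + len n (reflect n \<alpha>))"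
proof -
  interpret affine_type_A n using assms(1) by unfold_locales
  obtain p q where \<alpha>: "\<alpha> = root p q" and less: "p < q" "\<not> cg p q"
    using assms(2) by (auto simp: pos_real_roots_eq)
  \<comment> \<open>A longer interval would count the class of \<open>p\<close> twice, while the
    coefficients of a root below \<open>cc n\<close> are at most \<open>1\<close>.\<close>
  have "q < p + int n"
  proof (rule ccontr)
    assume "\<not> q < p + int n"
    then have "p + int n < q" using less(2) by (cases "q = p + int n") auto
    then have "1 \<le> arc (p + int n) q (p + 1 * int n)" by (intro arc_ge_1) auto
    then have "2 \<le> arc p q p"
      using arc_add[of p "p + int n" p q] arc_full_one[of p p] unfolding arc_index by simp
    moreover have "arc p q p \<le> 1"
      using assms(3) unfolding \<alpha> cc_eq[of 0] less_le root_le_iff arc_full_one by simp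
    ultimately show False by simp
  qed
  then interpret interval_degree n "int m" p q
    using assms(4) less by unfold_locales auto
  \<comment> \<open>Merges the two families of the theorem into one map on roots;
    \<open>act_top_elem\<close> covers either choice of the translation vector.\<close>
  define T where "T \<beta> = transl n (int m *\<^sub>Z (if simple_root 0 \<in> supp n \<beta> then \<beta> - cc n else \<beta>))
    \<circ> reflect n \<alpha>" for \<beta>
  have T: "T (param_root x y) = act (top_elem x y)" for x y
    unfolding T_def \<alpha> by (rule act_top_elem[symmetric]) auto
  have nbhd: "curve_nbhd n (int m *\<^sub>Z cc n + \<alpha>) id = T ` pos_real_roots_at n \<alpha>"
  proof -
    have "T ` pos_real_roots_at n \<alpha> = {T (param_root x y) | x y. param x y}"
      unfolding \<alpha> pos_real_roots_at_eq by blast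
    then show ?thesis unfolding T unfolding \<alpha> curve_nbhd_eq by simp
  qed
  moreover have "T ` pos_real_roots_at n \<alpha> =
      {transl n (int m *\<^sub>Z \<beta>) \<circ> reflect n \<alpha> | \<beta>.
        \<beta> \<in> pos_real_roots_at n \<alpha> \<and> simple_root 0 \<notin> supp n \<beta>}
      \<union> {transl n (int m *\<^sub>Z (\<beta> - cc n)) \<circ> reflect n \<alpha> | \<beta>.
        \<beta> \<in> pos_real_roots_at n \<alpha> \<and> simple_root 0 \<in> supp n \<beta>}" (is "_ = ?A \<union> ?B")
  proof (intro subset_antisym subsetI)
    fix v assume "v \<in> T ` pos_real_roots_at n \<alpha>"
    then obtain \<beta> where "\<beta> \<in> pos_real_roots_at n \<alpha>" "v = T \<beta>" by blast
    then show "v \<in> ?A \<union> ?B" unfolding T_def by (cases "simple_root 0 \<in> supp n \<beta>") auto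
  next
    fix v assume "v \<in> ?A \<union> ?B"
    then obtain \<beta> where \<beta>: "\<beta> \<in> pos_real_roots_at n \<alpha>" "v = T \<beta>" unfolding T_def by force
    then show "v \<in> T ` pos_real_roots_at n \<alpha>" by blast
  qed
  moreover have "inj_on T (pos_real_roots_at n \<alpha>)"
  proof (rule inj_onI)
    fix \<beta> \<beta>' assume \<beta>: "\<beta> \<in> pos_real_roots_at n \<alpha>" "\<beta>' \<in> pos_real_roots_at n \<alpha>" "T \<beta> = T \<beta>'"
    then obtain x y x' y' where "param x y" "\<beta> = param_root x y" "param x' y'" "\<beta>' = param_root x' y'"
      unfolding \<alpha> pos_real_roots_at_eq by blast
    then show "\<beta> = \<beta>'" using act_top_elem_inject[of x y x' y'] \<beta>(3) T by simp
  qed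
  then have "card (curve_nbhd n (int m *\<^sub>Z cc n + \<alpha>) id) = card (pos_real_roots_at n \<alpha>)"
    unfolding nbhd by (rule card_image)
  moreover have "len n w = 2 * m * (n - 1) + len n (reflect n \<alpha>)"
    if w: "w \<in> curve_nbhd n (int m *\<^sub>Z cc n + \<alpha>) id" for w
  proof -
    obtain x y where "param x y" "w = act (top_elem x y)"
      using w unfolding \<alpha> curve_nbhd_eq by blast
    then have "int (len n w) = int (2 * m * (n - 1) + len n (reflect n \<alpha>))"
      using len_top_elem[of x y] act_trp[OF less(2)] assms(1) by (simp add: \<alpha> of_nat_diff)
    then show ?thesis by (simp only: of_nat_eq_iff)
  qed
  ultimately show ?thesis by auto
qed

end
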